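(* Let $(m_l)_{l\ge3}$ be integers with $|m_l|\le l$ and $\lim_{l\to\infty}m_l/l=q\in[-1,1]$. Then $$\lim_{l\to\infty}C(e^0_3,e^{m_l}_l)=-\frac{525}{32\pi}q^4(1-q^2).$$
   Context: $C$ is the sectional curvature of $\mathrm{SDiff}(\mathbb S^2)$ (right-invariant $L^2$ metric for the area form $\sin\theta\,d\theta\wedge d\phi$), defined for complex directions by $C(u,v)=\langle R(u,v)u,v\rangle/(\|u\|^2\|v\|^2-|\langle u,v\rangle|^2)$ with $R$ extended complex-linearly and the Hermitian $L^2$ product; $R(u,v)w=-\nabla_u\nabla_vw+\nabla_v\nabla_uw+\nabla_{[u,v]}w$, $\nabla_uv=\frac12([u,v]-B(u,v)-B(v,u))$, $\langle B(u,v),w\rangle=\langle u,[v,w]\rangle$. $e^m_l=\mathrm{sgrad}(Y^m_l/\sqrt{l(l+1)})$, $\mathrm{sgrad}f=\frac1{\sin\theta}(\partial_\phi f\partial_\theta-\partial_\theta f\partial_\phi)$, where $Y^m_l=\big[\frac{(l-m)!}{(l+m)!}\frac{2l+1}{4\pi}\big]^{1/2}e^{im\phi}P^m_l(\cos\theta)$, $P^m_l(z)=(1-z^2)^{m/2}\frac1{2^ll!}\frac{d^{l+m}}{dz^{l+m}}(z^2-1)^l$. In particular $e^0_3=\frac18\sqrt{21/\pi}(5\cos^2\theta-1)\partial_\phi$. *)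

theory Defs
  imports "HOL-Analysis.Analysis"
begin

fun Ck :: "nat \<Rightarrow> ('a::euclidean_space \<Rightarrow> 'b::real_normed_vector) set" where
  "Ck 0 = {f. continuous_on UNIV f}"
| "Ck (Suc k) = {f. (\<forall>x. f differentiable (at x)) \<and>
                    (\<forall>v. (\<lambda>x. frechet_derivative f (at x) v) \<in> Ck k)}"

definition smoothC :: "('a::euclidean_space \<Rightarrow> 'b::real_normed_vector) \<Rightarrow> bool" where
  "smoothC f \<longleftrightarrow> (\<forall>k. f \<in> Ck k)"

text \<open>A (complexified) vector field in the chart is given by its components
  (a, b), meaning a d/dtheta + b d/dphi, as functions of (theta, phi).\<close>

type_synonym vfield = "real \<times> real \<Rightarrow> complex \<times> complex"

definition sph :: "real \<times> real \<Rightarrow> real \<times> real \<times> real" where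
  "sph p = (sin (fst p) * cos (snd p), sin (fst p) * sin (snd p), cos (fst p))"

definition d_theta :: "(real \<times> real \<Rightarrow> complex) \<Rightarrow> real \<times> real \<Rightarrow> complex" where
  "d_theta F p = vector_derivative (\<lambda>t. F (t, snd p)) (at (fst p))"

definition d_phi :: "(real \<times> real \<Rightarrow> complex) \<Rightarrow> real \<times> real \<Rightarrow> complex" where
  "d_phi F p = vector_derivative (\<lambda>t. F (fst p, t)) (at (snd p))"

definition sgrad :: "(real \<times> real \<Rightarrow> complex) \<Rightarrow> vfield" where
  "sgrad F p = (d_phi F p / complex_of_real (sin (fst p)),
               - d_theta F p / complex_of_real (sin (fst p)))"

text \<open>Smooth (complexified) divergence-free vector fields on S^2:
  symplectic gradients of smooth functions on the sphere.\<close>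
definition SVect :: "vfield set" where
  "SVect = {sgrad (\<lambda>p. f (sph p)) | f :: real \<times> real \<times> real \<Rightarrow> complex. smoothC f}"

definition vadd :: "vfield \<Rightarrow> vfield \<Rightarrow> vfield" where
  "vadd X Y p = (fst (X p) + fst (Y p), snd (X p) + snd (Y p))"

definition vscale :: "complex \<Rightarrow> vfield \<Rightarrow> vfield" where
  "vscale c X p = (c * fst (X p), c * snd (X p))"

definition vsub :: "vfield \<Rightarrow> vfield \<Rightarrow> vfield" where
  "vsub X Y = vadd X (vscale (-1) Y)"

definition dir_der :: "vfield \<Rightarrow> (real \<times> real \<Rightarrow> complex) \<Rightarrow> real \<times> real \<Rightarrow> complex" where
  "dir_der X g p = fst (X p) * d_theta g p + snd (X p) * d_phi g p"

definition lie :: "vfield \<Rightarrow> vfield \<Rightarrow> vfield" where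
  "lie X Y p = (dir_der X (\<lambda>q. fst (Y q)) p - dir_der Y (\<lambda>q. fst (X q)) p,
               dir_der X (\<lambda>q. snd (Y q)) p - dir_der Y (\<lambda>q. snd (X q)) p)"

text \<open>The chart domain (0,pi) x (0,2pi); area form sin theta dtheta dphi;
  round metric |d/dtheta|^2 = 1, |d/dphi|^2 = sin^2 theta.\<close>
definition chart :: "(real \<times> real) set" where
  "chart = {0<..<pi} \<times> {0<..<2*pi}"

definition herm :: "vfield \<Rightarrow> vfield \<Rightarrow> complex" where
  "herm X Y = (LINT p : chart | lborel.
      (fst (X p) * cnj (fst (Y p)) + complex_of_real ((sin (fst p))\<^sup>2) * snd (X p) * cnj (snd (Y p)))
      * complex_of_real (sin (fst p)))"

definition bil :: "vfield \<Rightarrow> vfield \<Rightarrow> complex" where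
  "bil X Y = (LINT p : chart | lborel.
      (fst (X p) * fst (Y p) + complex_of_real ((sin (fst p))\<^sup>2) * snd (X p) * snd (Y p))
      * complex_of_real (sin (fst p)))"

definition Bop :: "vfield \<Rightarrow> vfield \<Rightarrow> vfield" where
  "Bop u v = (THE z. z \<in> SVect \<and> (\<forall>w\<in>SVect. bil z w = bil u (lie v w)))"

definition nabla :: "vfield \<Rightarrow> vfield \<Rightarrow> vfield" where
  "nabla u v = vscale (1/2) (vsub (vsub (lie u v) (Bop u v)) (Bop v u))"

definition Rcurv :: "vfield \<Rightarrow> vfield \<Rightarrow> vfield \<Rightarrow> vfield" where
  "Rcurv u v w = vadd (vadd (vscale (-1) (nabla u (nabla v w))) (nabla v (nabla u w)))
                      (nabla (lie u v) w)"

definition sec_curv :: "vfield \<Rightarrow> vfield \<Rightarrow> complex" where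
  "sec_curv u v = herm (Rcurv u v u) v /
     (herm u u * herm v v - complex_of_real ((cmod (herm u v))\<^sup>2))"

definition assoc_leg :: "nat \<Rightarrow> int \<Rightarrow> real \<Rightarrow> real" where
  "assoc_leg l m z = (1 - z\<^sup>2) powr (real_of_int m / 2) * (1 / (2 ^ l * fact l)) *
      (deriv ^^ nat (int l + m)) (\<lambda>x. (x\<^sup>2 - 1) ^ l) z"

definition Ysh :: "nat \<Rightarrow> int \<Rightarrow> real \<times> real \<Rightarrow> complex" where
  "Ysh l m p = complex_of_real (sqrt (fact (nat (int l - m)) / fact (nat (int l + m))
                 * (2 * real l + 1) / (4 * pi)))
             * exp (\<i> * of_int m * of_real (snd p))
             * complex_of_real (assoc_leg l m (cos (fst p)))"

definition ebasis :: "nat \<Rightarrow> int \<Rightarrow> vfield" where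
  "ebasis l m = sgrad (\<lambda>p. Ysh l m p / complex_of_real (sqrt (real l * (real l + 1))))"

end

theory Submission
  imports Defs "HOL-Computational_Algebra.Polynomial" "HOL-Real_Asymp.Real_Asymp"
begin

text \<open>For stream functions, \<open>[sgrad f, sgrad g] = sgrad {f, g}\<close>, and Green's identity turns the
  definition of \<open>B\<close> into \<open>B(sgrad f, sgrad g) = sgrad (\<Delta>\<^sup>-\<^sup>1 {\<Delta>f, g})\<close>. So if \<open>\<Delta>\<psi> = - \<nu> \<psi>\<close> and the
  bracket with \<open>\<psi>\<close> acts as a matrix \<open>c\<close> on a family of eigenfunctions \<open>E\<close> of \<open>\<Delta>\<close>, then the
  sectional curvature of \<open>sgrad \<psi>\<close> and \<open>sgrad (E l)\<close> is a weighted sum of the products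
  \<open>c l k * c k l\<close>. On the chart \<open>e\<^sup>0\<^sub>3\<close> is \<open>\<kappa> (5 cos\<^sup>2 \<theta> - 1) \<partial>\<phi>\<close> with \<open>\<kappa>\<^sup>2 = 21/(64 \<pi>)\<close>, so that on
  the harmonics of order \<open>m\<close> the bracket is multiplication by \<open>i m \<kappa> (5 cos\<^sup>2 \<theta> - 1)\<close>, which by the
  three-term recurrence of the Legendre functions couples the degree \<open>l\<close> only to \<open>l - 2\<close>, \<open>l\<close>,
  \<open>l + 2\<close>. The contributions of \<open>l \<plusminus> 2\<close> are of order \<open>l\<close> and cancel to leading order; the limit
  comes from the variation of the recurrence coefficients with \<open>l\<close>.\<close>

section \<open>Smooth maps\<close>

lemma Ck_Suc_has_derivative:
  "f \<in> Ck (Suc k) \<Longrightarrow> (f has_derivative frechet_derivative f (at x)) (at x)"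
  by (simp flip: frechet_derivative_works)

lemma Ck_Suc_frechet_derivative: "f \<in> Ck (Suc k) \<Longrightarrow> (\<lambda>x. frechet_derivative f (at x) v) \<in> Ck k"
  by simp

lemma Ck_SucI:
  assumes "\<And>x. (f has_derivative f' x) (at x)" "\<And>v. (\<lambda>x. f' x v) \<in> Ck k"
  shows "f \<in> Ck (Suc k)"
proof -
  have "frechet_derivative f (at x) = f' x" for x
    by (rule frechet_derivative_at[OF assms(1), symmetric])
  then show ?thesis
    using assms by (auto intro: differentiableI)
qed

lemma Ck_Suc_imp_Ck: "f \<in> Ck (Suc k) \<Longrightarrow> f \<in> Ck k"
proof (induction k arbitrary: f)
  case 0
  then show ?case
    by (auto intro!: continuous_at_imp_continuous_on differentiable_imp_continuous_within)
qed auto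

lemma Ck_const: "(\<lambda>x. c) \<in> Ck k"
  by (induction k arbitrary: c) auto

lemma Ck_bounded_linear:
  assumes "bounded_linear L"
  shows "L \<in> Ck k"
proof (cases k)
  case 0
  then show ?thesis
    using assms by (simp add: linear_continuous_on)
next
  case (Suc j)
  have "(L has_derivative L) (at x)" for x
    by (rule bounded_linear.has_derivative[OF assms has_derivative_ident])
  then show ?thesis
    unfolding Suc by (rule Ck_SucI) (rule Ck_const)
qed

lemma Ck_add:
  assumes "f \<in> Ck k" "g \<in> Ck k"
  shows "(\<lambda>x. f x + g x) \<in> Ck k"
  using assms
proof (induction k arbitrary: f g)
  case 0
  then show ?case by (auto intro: continuous_intros)
next
  case (Suc k)
  show ?case
    by (rule Ck_SucI, rule has_derivative_add[OF Suc.prems[THEN Ck_Suc_has_derivative]])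
      (intro Suc.IH Suc.prems[THEN Ck_Suc_frechet_derivative])
qed

lemma Ck_sum: "(\<And>i. i \<in> I \<Longrightarrow> f i \<in> Ck k) \<Longrightarrow> (\<lambda>x. \<Sum>i\<in>I. f i x) \<in> Ck k"
  by (induction I rule: infinite_finite_induct) (auto intro: Ck_const Ck_add)

lemma Ck_bounded_bilinear:
  assumes "bounded_bilinear B" "f \<in> Ck k" "g \<in> Ck k"
  shows "(\<lambda>x. B (f x) (g x)) \<in> Ck k"
  using assms(2,3)
proof (induction k arbitrary: f g)
  case 0
  then show ?case using bounded_bilinear.continuous_on[OF assms(1)] by simp
next
  case (Suc k)
  show ?case
    by (rule Ck_SucI, rule bounded_bilinear.FDERIV[OF assms(1) Suc.prems[THEN Ck_Suc_has_derivative]])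
      (intro Ck_add Suc.IH Suc.prems[THEN Ck_Suc_frechet_derivative] Suc.prems[THEN Ck_Suc_imp_Ck])
qed

lemma Ck_compose:
  fixes f :: "'b::euclidean_space \<Rightarrow> 'c::real_normed_vector" and g :: "'a::euclidean_space \<Rightarrow> 'b"
  assumes "f \<in> Ck k" "g \<in> Ck k"
  shows "(\<lambda>x. f (g x)) \<in> Ck k"
  using assms
proof (induction k arbitrary: f)
  case 0
  then show ?case using continuous_on_compose2[of UNIV f UNIV g] by simp
next
  case (Suc k)
  let ?Df = "\<lambda>y. frechet_derivative f (at y)" and ?Dg = "\<lambda>x. frechet_derivative g (at x)"
  have basis_expansion: "?Df (g x) (?Dg x v) = (\<Sum>b\<in>Basis. (?Dg x v \<bullet> b) *\<^sub>R ?Df (g x) b)" for x v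
  proof -
    have "linear (?Df (g x))"
      by (rule has_derivative_linear[OF Ck_Suc_has_derivative[OF Suc.prems(1)]])
    then have "(\<Sum>b\<in>Basis. (?Dg x v \<bullet> b) *\<^sub>R ?Df (g x) b) = ?Df (g x) (\<Sum>b\<in>Basis. (?Dg x v \<bullet> b) *\<^sub>R b)"
      by (simp add: linear_sum linear_scale)
    then show ?thesis by (simp add: euclidean_representation)
  qed
  show ?case
  proof (rule Ck_SucI)
    show "((\<lambda>x. f (g x)) has_derivative (\<lambda>v. ?Df (g x) (?Dg x v))) (at x)" for x
      using Suc.prems[THEN Ck_Suc_has_derivative] by (rule has_derivative_compose[rotated])
    have "(\<lambda>x. (?Dg x v \<bullet> b) *\<^sub>R ?Df (g x) b) \<in> Ck k" for v b
      by (intro Ck_bounded_bilinear[OF bounded_bilinear_scaleR] Ck_bounded_bilinear[OF bounded_bilinear_inner]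
          Ck_const Suc.IH[of "\<lambda>y. ?Df y b"] Suc.prems[THEN Ck_Suc_frechet_derivative]
          Suc.prems(2)[THEN Ck_Suc_imp_Ck])
    then show "(\<lambda>x. ?Df (g x) (?Dg x v)) \<in> Ck k" for v
      unfolding basis_expansion by (intro Ck_sum)
  qed
qed

lemma Ck_sin: "(sin :: real \<Rightarrow> real) \<in> Ck k" and Ck_cos: "(cos :: real \<Rightarrow> real) \<in> Ck k"
proof -
  have "(sin :: real \<Rightarrow> real) \<in> Ck k \<and> (cos :: real \<Rightarrow> real) \<in> Ck k"
  proof (induction k)
    case (Suc k)
    have "(\<lambda>x. cos x * v) \<in> Ck k" "(\<lambda>x. sin x * - v) \<in> Ck k" for v :: real
      using Suc.IH by (intro Ck_bounded_bilinear[OF bounded_bilinear_mult] Ck_const; simp)+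
    then show ?case
      by (intro conjI Ck_SucI[OF DERIV_sin[unfolded has_field_derivative_def]]
          Ck_SucI[OF DERIV_cos[unfolded has_field_derivative_def]]) simp_all
  qed (auto intro: continuous_intros)
  then show "(sin :: real \<Rightarrow> real) \<in> Ck k" "(cos :: real \<Rightarrow> real) \<in> Ck k" by auto
qed

lemma smoothC_const: "smoothC (\<lambda>x. c)"
  and smoothC_bounded_linear: "bounded_linear L \<Longrightarrow> smoothC L"
  and smoothC_add: "smoothC f \<Longrightarrow> smoothC g \<Longrightarrow> smoothC (\<lambda>x. f x + g x)"
  by (auto simp: smoothC_def Ck_const Ck_bounded_linear Ck_add)

lemma smoothC_mult:
  fixes f g :: "'a::euclidean_space \<Rightarrow> 'b::real_normed_algebra"
  shows "smoothC f \<Longrightarrow> smoothC g \<Longrightarrow> smoothC (\<lambda>x. f x * g x)"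
  by (simp add: smoothC_def Ck_bounded_bilinear[OF bounded_bilinear_mult])

lemma smoothC_compose:
  fixes f :: "'b::euclidean_space \<Rightarrow> 'c::real_normed_vector" and g :: "'a::euclidean_space \<Rightarrow> 'b"
  shows "smoothC f \<Longrightarrow> smoothC g \<Longrightarrow> smoothC (\<lambda>x. f (g x))"
  by (simp add: smoothC_def Ck_compose)

lemma smoothC_ident: "smoothC (\<lambda>x. x)"
  by (rule smoothC_bounded_linear[OF bounded_linear_ident])

lemma smoothC_sin: "smoothC f \<Longrightarrow> smoothC (\<lambda>x. sin (f x :: real))"
  and smoothC_cos: "smoothC f \<Longrightarrow> smoothC (\<lambda>x. cos (f x :: real))"
  by (simp_all add: smoothC_def Ck_compose Ck_sin Ck_cos)

lemma smoothC_of_real: "smoothC f \<Longrightarrow> smoothC (\<lambda>x. complex_of_real (f x))"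
  and smoothC_cnj: "smoothC g \<Longrightarrow> smoothC (\<lambda>x. cnj (g x))"
  using smoothC_compose smoothC_bounded_linear bounded_linear_of_real bounded_linear_cnj by blast+

lemma smoothC_uminus: "smoothC f \<Longrightarrow> smoothC (\<lambda>x. - (f x :: 'b::euclidean_space))"
  using smoothC_compose smoothC_bounded_linear[OF bounded_linear_minus[OF bounded_linear_ident]] by blast

lemma smoothC_diff: "smoothC f \<Longrightarrow> smoothC g \<Longrightarrow> smoothC (\<lambda>x. f x - (g x :: 'b::euclidean_space))"
  using smoothC_add[OF _ smoothC_uminus] by fastforce

lemma smoothC_fst: "smoothC f \<Longrightarrow> smoothC (\<lambda>x. fst (f x :: 'a::euclidean_space \<times> 'b::euclidean_space))"
  and smoothC_snd: "smoothC f \<Longrightarrow> smoothC (\<lambda>x. snd (f x :: 'a::euclidean_space \<times> 'b::euclidean_space))"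
  using smoothC_compose smoothC_bounded_linear bounded_linear_fst bounded_linear_snd by blast+

lemma smoothC_Pair:
  fixes f :: "'a::euclidean_space \<Rightarrow> 'b::euclidean_space" and g :: "'a \<Rightarrow> 'c::euclidean_space"
  assumes "smoothC f" "smoothC g"
  shows "smoothC (\<lambda>x. (f x, g x))"
proof -
  have "smoothC (\<lambda>y::'b. (y, 0::'c))" "smoothC (\<lambda>y::'c. (0::'b, y))"
    by (intro smoothC_bounded_linear bounded_linear_Pair bounded_linear_ident bounded_linear_zero)+
  from this[THEN smoothC_compose] have "smoothC (\<lambda>x. (f x, 0) + (0, g x))"
    using assms by (intro smoothC_add)
  then show ?thesis by simp
qed

lemmas smoothC_intros = smoothC_const smoothC_ident smoothC_add smoothC_uminus smoothC_diff smoothC_mult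
  smoothC_of_real smoothC_cnj smoothC_sin smoothC_cos smoothC_fst smoothC_snd smoothC_Pair

lemma smoothC_frechet_derivative: "smoothC f \<Longrightarrow> smoothC (\<lambda>x. frechet_derivative f (at x) v)"
  unfolding smoothC_def using Ck_Suc_frechet_derivative by blast

lemma smoothC_has_derivative: "smoothC f \<Longrightarrow> (f has_derivative frechet_derivative f (at x)) (at x)"
  unfolding smoothC_def by (rule Ck_Suc_has_derivative) blast

lemma smoothC_continuous_on: "smoothC f \<Longrightarrow> continuous_on A f"
  unfolding smoothC_def by (metis Ck.simps(1) continuous_on_subset mem_Collect_eq subset_UNIV)

lemma smoothC_has_vector_derivative_compose:
  assumes F: "smoothC F" and "(\<gamma> has_vector_derivative v) (at t)"
  shows "((\<lambda>t. F (\<gamma> t)) has_vector_derivative frechet_derivative F (at (\<gamma> t)) v) (at t)"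
proof -
  let ?D = "frechet_derivative F (at (\<gamma> t))"
  have "((\<lambda>t. F (\<gamma> t)) has_derivative (\<lambda>h. ?D (h *\<^sub>R v))) (at t)"
    using assms(2) smoothC_has_derivative[OF F]
    unfolding has_vector_derivative_def by (rule has_derivative_compose)
  then show ?thesis
    unfolding has_vector_derivative_def
    by (simp only: linear_scale[OF has_derivative_linear[OF smoothC_has_derivative[OF F]]])
qed

lemma smoothC_continuous_on_Pair: "smoothC F \<Longrightarrow> continuous_on S (\<lambda>t. F (a, t))"
  using smoothC_continuous_on[of F UNIV] by (rule continuous_on_compose2) (auto intro: continuous_intros)

section \<open>Smooth functions of the spherical coordinates\<close>

abbreviation sn :: "real \<times> real \<Rightarrow> complex" where
  "sn p \<equiv> complex_of_real (sin (fst p))"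

abbreviation cs :: "real \<times> real \<Rightarrow> complex" where
  "cs p \<equiv> complex_of_real (cos (fst p))"

lemma cs_sq: "(cs p)\<^sup>2 = 1 - (sn p)\<^sup>2"
  by (simp add: cos_squared_eq flip: of_real_power)

lemma d_theta_eqI:
  "(\<And>a b. ((\<lambda>t. F (t, b)) has_vector_derivative F' (a, b)) (at a)) \<Longrightarrow> d_theta F = F'"
  by (auto simp: d_theta_def fun_eq_iff intro!: vector_derivative_at)

lemma d_phi_eqI:
  "(\<And>a b. ((\<lambda>t. F (a, t)) has_vector_derivative F' (a, b)) (at b)) \<Longrightarrow> d_phi F = F'"
  by (auto simp: d_phi_def fun_eq_iff intro!: vector_derivative_at)

lemma
  assumes "smoothC F"
  shows d_theta_eq_frechet_derivative: "d_theta F = (\<lambda>p. frechet_derivative F (at p) (1, 0))"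
    and smoothC_has_d_theta: "((\<lambda>t. F (t, b)) has_vector_derivative d_theta F (a, b)) (at a)"
proof -
  have "((\<lambda>t. (t, b)) has_vector_derivative (1, 0)) (at a)" for a b :: real
    by (auto intro!: derivative_eq_intros)
  note deriv = smoothC_has_vector_derivative_compose[OF assms this]
  then show "d_theta F = (\<lambda>p. frechet_derivative F (at p) (1, 0))"
    by (rule d_theta_eqI)
  with deriv show "((\<lambda>t. F (t, b)) has_vector_derivative d_theta F (a, b)) (at a)" by simp
qed

lemma
  assumes "smoothC F"
  shows d_phi_eq_frechet_derivative: "d_phi F = (\<lambda>p. frechet_derivative F (at p) (0, 1))"
    and smoothC_has_d_phi: "((\<lambda>t. F (a, t)) has_vector_derivative d_phi F (a, b)) (at b)"
proof -
  have "((\<lambda>t. (a, t)) has_vector_derivative (0, 1)) (at b)" for a b :: real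
    by (auto intro!: derivative_eq_intros)
  note deriv = smoothC_has_vector_derivative_compose[OF assms this]
  then show "d_phi F = (\<lambda>p. frechet_derivative F (at p) (0, 1))"
    by (rule d_phi_eqI)
  with deriv show "((\<lambda>t. F (a, t)) has_vector_derivative d_phi F (a, b)) (at b)" by simp
qed

lemma smoothC_d_theta: "smoothC F \<Longrightarrow> smoothC (d_theta F)"
  and smoothC_d_phi: "smoothC F \<Longrightarrow> smoothC (d_phi F)"
  by (simp_all add: d_theta_eq_frechet_derivative d_phi_eq_frechet_derivative smoothC_frechet_derivative)

lemma d_theta_eq_integral:
  assumes F: "smoothC F" and "c \<le> y"
  shows "d_theta F (a, y) = d_theta F (a, c) + integral {c..y} (\<lambda>t. d_theta (d_phi F) (a, t))"
proof -
  have F_eq: "F (x, y) = F (x, c) + integral {c..y} (\<lambda>t. d_phi F (x, t))" for x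
    using fundamental_theorem_of_calculus[OF \<open>c \<le> y\<close>, of "\<lambda>t. F (x, t)" "\<lambda>t. d_phi F (x, t)"]
    by (simp add: smoothC_has_d_phi[OF F] has_vector_derivative_at_within integral_unique)
  have "((\<lambda>x. integral (cbox c y) (\<lambda>t. d_phi F (x, t))) has_vector_derivative
      integral (cbox c y) (\<lambda>t. d_theta (d_phi F) (a, t))) (at a within UNIV)"
    by (rule leibniz_rule_vector_derivative)
      (auto intro!: integrable_continuous_interval smoothC_continuous_on smoothC_continuous_on_Pair
        smoothC_has_d_theta smoothC_d_theta smoothC_d_phi F)
  then have "((\<lambda>x. F (x, c) + integral {c..y} (\<lambda>t. d_phi F (x, t))) has_vector_derivative
      d_theta F (a, c) + integral {c..y} (\<lambda>t. d_theta (d_phi F) (a, t))) (at a)"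
    by (intro has_vector_derivative_add smoothC_has_d_theta[OF F]) simp
  then show ?thesis
    unfolding F_eq[symmetric] by (simp add: d_theta_def vector_derivative_at)
qed

lemma d_phi_d_theta_commute:
  assumes F: "smoothC F"
  shows "d_phi (d_theta F) = d_theta (d_phi F)"
proof (rule d_phi_eqI)
  fix a b :: real
  have "((\<lambda>y. integral {b - 1..y} (\<lambda>t. d_theta (d_phi F) (a, t))) has_vector_derivative
      d_theta (d_phi F) (a, b)) (at b within {b - 1..b + 1})"
    by (rule integral_has_vector_derivative)
      (auto intro: smoothC_continuous_on_Pair smoothC_d_theta smoothC_d_phi F)
  then have "((\<lambda>y. d_theta F (a, b - 1) + integral {b - 1..y} (\<lambda>t. d_theta (d_phi F) (a, t)))
      has_vector_derivative d_theta (d_phi F) (a, b)) (at b within {b - 1..b + 1})"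
    using has_vector_derivative_add[OF has_vector_derivative_const] by fastforce
  then have "((\<lambda>y. d_theta F (a, y)) has_vector_derivative d_theta (d_phi F) (a, b))
      (at b within {b - 1..b + 1})"
    by (rule has_vector_derivative_transform[rotated 2])
      (simp_all add: d_theta_eq_integral[OF F, symmetric])
  then show "((\<lambda>y. d_theta F (a, y)) has_vector_derivative d_theta (d_phi F) (a, b)) (at b)"
    by (simp add: at_within_Icc_at)
qed

definition chart_smooth :: "(real \<times> real \<Rightarrow> complex) \<Rightarrow> bool" where
  "chart_smooth F \<longleftrightarrow> smoothC F \<and> (\<forall>a b. F (a, b + 2 * pi) = F (a, b))"

lemma chart_smooth_imp_smoothC: "chart_smooth F \<Longrightarrow> smoothC F"
  and chart_smooth_periodic: "chart_smooth F \<Longrightarrow> F (a, b + 2 * pi) = F (a, b)"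
  by (auto simp: chart_smooth_def)

lemmas chart_smooth_continuous_on = smoothC_continuous_on[OF chart_smooth_imp_smoothC]
lemmas chart_smooth_has_d_theta = smoothC_has_d_theta[OF chart_smooth_imp_smoothC]
lemmas chart_smooth_has_d_phi = smoothC_has_d_phi[OF chart_smooth_imp_smoothC]

lemma chart_smooth_const: "chart_smooth (\<lambda>p. c)"
  and chart_smooth_add: "chart_smooth F \<Longrightarrow> chart_smooth H \<Longrightarrow> chart_smooth (\<lambda>p. F p + H p)"
  and chart_smooth_uminus: "chart_smooth F \<Longrightarrow> chart_smooth (\<lambda>p. - F p)"
  and chart_smooth_diff: "chart_smooth F \<Longrightarrow> chart_smooth H \<Longrightarrow> chart_smooth (\<lambda>p. F p - H p)"
  and chart_smooth_mult: "chart_smooth F \<Longrightarrow> chart_smooth H \<Longrightarrow> chart_smooth (\<lambda>p. F p * H p)"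
  and chart_smooth_cnj: "chart_smooth F \<Longrightarrow> chart_smooth (\<lambda>p. cnj (F p))"
  by (simp_all add: chart_smooth_def smoothC_intros)

lemma chart_smooth_sn: "chart_smooth sn" and chart_smooth_cs: "chart_smooth cs"
  unfolding chart_smooth_def by (intro conjI allI smoothC_intros; simp)+

lemma chart_smooth_power: "chart_smooth F \<Longrightarrow> chart_smooth (\<lambda>p. F p ^ n)"
  by (induction n) (auto intro: chart_smooth_const chart_smooth_mult)

lemma chart_smooth_sum: "(\<And>i. i \<in> A \<Longrightarrow> chart_smooth (F i)) \<Longrightarrow> chart_smooth (\<lambda>p. \<Sum>i\<in>A. F i p)"
  by (induction A rule: infinite_finite_induct) (auto intro: chart_smooth_const chart_smooth_add)

lemma chart_smooth_d_theta:
  assumes "chart_smooth F"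
  shows "chart_smooth (d_theta F)"
  using assms by (auto simp: chart_smooth_def smoothC_d_theta d_theta_def)

lemma chart_smooth_d_phi:
  assumes F: "chart_smooth F"
  shows "chart_smooth (d_phi F)"
  unfolding chart_smooth_def
proof (intro conjI allI)
  show "smoothC (d_phi F)"
    by (rule smoothC_d_phi[OF chart_smooth_imp_smoothC[OF F]])
  fix a b
  have "((\<lambda>t. t + 2 * pi) has_vector_derivative 1) (at b)"
    by (auto intro!: derivative_eq_intros)
  from vector_diff_chain_at[OF this chart_smooth_has_d_phi[OF F]]
  have "((\<lambda>t. F (a, t)) has_vector_derivative d_phi F (a, b + 2 * pi)) (at b)"
    by (simp add: o_def chart_smooth_periodic[OF F])
  then show "d_phi F (a, b + 2 * pi) = d_phi F (a, b)"
    by (simp add: d_phi_def vector_derivative_at)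
qed

lemmas chart_smooth_rules =
  chart_smooth_const chart_smooth_sn chart_smooth_cs chart_smooth_uminus chart_smooth_add
  chart_smooth_diff chart_smooth_mult chart_smooth_power chart_smooth_sum chart_smooth_cnj
  chart_smooth_d_theta chart_smooth_d_phi

lemma d_theta_simps:
  "d_theta (\<lambda>p. c) = (\<lambda>p. 0)"
  "d_theta sn = cs"
  "d_theta cs = (\<lambda>p. - sn p)"
  "chart_smooth F \<Longrightarrow> d_theta (\<lambda>p. - F p) = (\<lambda>p. - d_theta F p)"
  "chart_smooth F \<Longrightarrow> chart_smooth H \<Longrightarrow> d_theta (\<lambda>p. F p + H p) = (\<lambda>p. d_theta F p + d_theta H p)"
  "chart_smooth F \<Longrightarrow> chart_smooth H \<Longrightarrow> d_theta (\<lambda>p. F p - H p) = (\<lambda>p. d_theta F p - d_theta H p)"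
  "chart_smooth F \<Longrightarrow> chart_smooth H \<Longrightarrow>
      d_theta (\<lambda>p. F p * H p) = (\<lambda>p. F p * d_theta H p + d_theta F p * H p)"
  "chart_smooth F \<Longrightarrow> d_theta (\<lambda>p. cnj (F p)) = (\<lambda>p. cnj (d_theta F p))"
proof -
  show "d_theta cs = (\<lambda>p. - sn p)"
    unfolding of_real_minus[symmetric]
    by (rule d_theta_eqI, unfold fst_conv, rule has_vector_derivative_of_real)
      (auto intro!: derivative_eq_intros)
qed (rule d_theta_eqI; auto intro!: has_vector_derivative_minus has_vector_derivative_add
    has_vector_derivative_diff has_vector_derivative_mult has_vector_derivative_of_real
    has_vector_derivative_cnj chart_smooth_has_d_theta derivative_eq_intros)+

lemma d_phi_simps:
  "d_phi (\<lambda>p. c) = (\<lambda>p. 0)"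
  "d_phi sn = (\<lambda>p. 0)"
  "d_phi cs = (\<lambda>p. 0)"
  "chart_smooth F \<Longrightarrow> d_phi (\<lambda>p. - F p) = (\<lambda>p. - d_phi F p)"
  "chart_smooth F \<Longrightarrow> chart_smooth H \<Longrightarrow> d_phi (\<lambda>p. F p + H p) = (\<lambda>p. d_phi F p + d_phi H p)"
  "chart_smooth F \<Longrightarrow> chart_smooth H \<Longrightarrow> d_phi (\<lambda>p. F p - H p) = (\<lambda>p. d_phi F p - d_phi H p)"
  "chart_smooth F \<Longrightarrow> chart_smooth H \<Longrightarrow> d_phi (\<lambda>p. F p * H p) = (\<lambda>p. F p * d_phi H p + d_phi F p * H p)"
  "chart_smooth F \<Longrightarrow> d_phi (\<lambda>p. cnj (F p)) = (\<lambda>p. cnj (d_phi F p))"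
  "chart_smooth F \<Longrightarrow> d_phi (d_theta F) = d_theta (d_phi F)"
  by (rule d_phi_eqI; auto intro!: has_vector_derivative_minus has_vector_derivative_add
    has_vector_derivative_diff has_vector_derivative_mult has_vector_derivative_cnj
    chart_smooth_has_d_phi)+
    (rule d_phi_d_theta_commute[OF chart_smooth_imp_smoothC])

section \<open>Smooth functions on the sphere\<close>

definition sphere_fun :: "(real \<times> real \<Rightarrow> complex) \<Rightarrow> bool" where
  "sphere_fun g \<longleftrightarrow> (\<exists>f. smoothC f \<and> g = (\<lambda>p. f (sph p)))"

lemma sphere_funI: "smoothC f \<Longrightarrow> sphere_fun (\<lambda>p. f (sph p))"
  by (auto simp: sphere_fun_def)

lemma SVect_eq: "SVect = {sgrad g | g. sphere_fun g}"
  by (auto simp: SVect_def sphere_fun_def)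

lemma smoothC_sph: "smoothC sph"
  unfolding sph_def by (intro smoothC_intros)

lemma sphere_fun_chart_smooth: "sphere_fun g \<Longrightarrow> chart_smooth g"
  unfolding sphere_fun_def chart_smooth_def
  by (auto intro: smoothC_compose[OF _ smoothC_sph]) (simp add: sph_def)

lemma sphere_fun_const: "sphere_fun (\<lambda>p. c)"
  using sphere_funI[OF smoothC_const] .

lemma sphere_fun_add: "sphere_fun g \<Longrightarrow> sphere_fun h \<Longrightarrow> sphere_fun (\<lambda>p. g p + h p)"
  unfolding sphere_fun_def using smoothC_add by blast

lemma sphere_fun_mult: "sphere_fun g \<Longrightarrow> sphere_fun h \<Longrightarrow> sphere_fun (\<lambda>p. g p * h p)"
  unfolding sphere_fun_def using smoothC_mult by blast

lemma sphere_fun_cnj: "sphere_fun g \<Longrightarrow> sphere_fun (\<lambda>p. cnj (g p))"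
  unfolding sphere_fun_def using smoothC_cnj by blast

lemma sphere_fun_power: "sphere_fun g \<Longrightarrow> sphere_fun (\<lambda>p. g p ^ n)"
  by (induction n) (auto intro: sphere_fun_const sphere_fun_mult)

lemma sphere_fun_sum: "(\<And>i. i \<in> I \<Longrightarrow> sphere_fun (g i)) \<Longrightarrow> sphere_fun (\<lambda>p. \<Sum>i\<in>I. g i p)"
  by (induction I rule: infinite_finite_induct) (auto intro: sphere_fun_const sphere_fun_add)

lemma sphere_fun_diff: "sphere_fun g \<Longrightarrow> sphere_fun h \<Longrightarrow> sphere_fun (\<lambda>p. g p - h p)"
  unfolding sphere_fun_def using smoothC_diff by blast

lemma sphere_fun_coords:
  "sphere_fun (\<lambda>p. sn p * of_real (cos (snd p)))"
  "sphere_fun (\<lambda>p. sn p * of_real (sin (snd p)))"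
  "sphere_fun cs"
proof -
  have "sphere_fun (\<lambda>p. complex_of_real (fst (sph p)))"
    "sphere_fun (\<lambda>p. complex_of_real (fst (snd (sph p))))"
    "sphere_fun (\<lambda>p. complex_of_real (snd (snd (sph p))))"
    by (rule sphere_funI[where f = "\<lambda>x. complex_of_real (fst x)"]
        sphere_funI[where f = "\<lambda>x. complex_of_real (fst (snd x))"]
        sphere_funI[where f = "\<lambda>x. complex_of_real (snd (snd x))"], intro smoothC_intros)+
  then show "sphere_fun (\<lambda>p. sn p * of_real (cos (snd p)))"
    "sphere_fun (\<lambda>p. sn p * of_real (sin (snd p)))"
    "sphere_fun cs"
    by (simp_all add: sph_def)
qed

lemmas sphere_fun_intros = sphere_fun_const sphere_fun_add sphere_fun_diff sphere_fun_mult sphere_fun_cnj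
  sphere_fun_power sphere_fun_sum sphere_fun_coords

definition ambient_deriv ::
  "(real \<times> real \<times> real \<Rightarrow> complex) \<Rightarrow> real \<times> real \<times> real \<Rightarrow> real \<times> real \<Rightarrow> complex" where
  "ambient_deriv f v p = frechet_derivative f (at (sph p)) v"

lemma sphere_fun_ambient_deriv: "smoothC f \<Longrightarrow> sphere_fun (ambient_deriv f v)"
  unfolding ambient_deriv_def[abs_def] by (intro sphere_funI smoothC_frechet_derivative)

lemma has_vector_derivative_comp_sph:
  fixes f :: "real \<times> real \<times> real \<Rightarrow> complex"
  assumes f: "smoothC f" and "((\<lambda>t. sph (\<gamma> t)) has_vector_derivative (x, y, z)) (at t)"
  shows "((\<lambda>t. f (sph (\<gamma> t))) has_vector_derivative of_real x * ambient_deriv f (1, 0, 0) (\<gamma> t)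
    + of_real y * ambient_deriv f (0, 1, 0) (\<gamma> t) + of_real z * ambient_deriv f (0, 0, 1) (\<gamma> t)) (at t)"
proof -
  have linear: "linear (frechet_derivative f (at (sph (\<gamma> t))))"
    by (rule has_derivative_linear[OF smoothC_has_derivative[OF f]])
  have "(x, y, z) = x *\<^sub>R (1, 0, 0) + y *\<^sub>R (0, 1, 0) + z *\<^sub>R (0, 0, 1)" by simp
  with smoothC_has_vector_derivative_compose[OF assms] show ?thesis
    unfolding ambient_deriv_def
    by (simp only: linear_scale[OF linear] linear_add[OF linear] scaleR_conv_of_real)
qed

lemma d_theta_comp_sph:
  assumes "smoothC f"
  shows "d_theta (\<lambda>p. f (sph p)) = (\<lambda>p. cs p * (of_real (cos (snd p)) * ambient_deriv f (1, 0, 0) p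
    + of_real (sin (snd p)) * ambient_deriv f (0, 1, 0) p) - sn p * ambient_deriv f (0, 0, 1) p)"
proof (rule d_theta_eqI)
  fix a b :: real
  have "((\<lambda>t. sph (t, b)) has_vector_derivative (cos a * cos b, cos a * sin b, - sin a)) (at a)"
    unfolding sph_def fst_conv snd_conv
    by (auto intro!: derivative_eq_intros simp flip: has_real_derivative_iff_has_vector_derivative)
  from has_vector_derivative_comp_sph[OF assms this]
  show "((\<lambda>t. f (sph (t, b))) has_vector_derivative
    cs (a, b) * (of_real (cos (snd (a, b))) * ambient_deriv f (1, 0, 0) (a, b)
    + of_real (sin (snd (a, b))) * ambient_deriv f (0, 1, 0) (a, b))
    - sn (a, b) * ambient_deriv f (0, 0, 1) (a, b)) (at a)"
    by (simp add: algebra_simps)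
qed

text \<open>The derivative along the parallels vanishes at the poles to first order, which makes the
  chart expressions below regular there.\<close>
lemma d_phi_comp_sph:
  assumes "smoothC f"
  shows "d_phi (\<lambda>p. f (sph p)) = (\<lambda>p. sn p * (of_real (cos (snd p)) * ambient_deriv f (0, 1, 0) p
    - of_real (sin (snd p)) * ambient_deriv f (1, 0, 0) p))"
proof (rule d_phi_eqI)
  fix a b :: real
  have "((\<lambda>t. sph (a, t)) has_vector_derivative (- (sin a * sin b), sin a * cos b, 0)) (at b)"
    unfolding sph_def fst_conv snd_conv
    by (auto intro!: derivative_eq_intros simp flip: has_real_derivative_iff_has_vector_derivative)
  from has_vector_derivative_comp_sph[OF assms this]
  show "((\<lambda>t. f (sph (a, t))) has_vector_derivative
    sn (a, b) * (of_real (cos (snd (a, b))) * ambient_deriv f (0, 1, 0) (a, b)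
    - of_real (sin (snd (a, b))) * ambient_deriv f (1, 0, 0) (a, b))) (at b)"
    by (simp add: algebra_simps)
qed

lemma sphere_fun_d_phi:
  assumes "sphere_fun g"
  obtains G where "chart_smooth G" "d_phi g = (\<lambda>p. sn p * G p)"
proof -
  obtain f where f: "smoothC f" "g = (\<lambda>p. f (sph p))"
    using assms by (auto simp: sphere_fun_def)
  have longitude: "chart_smooth (\<lambda>p. of_real (sin (snd p)))" "chart_smooth (\<lambda>p. of_real (cos (snd p)))"
    unfolding chart_smooth_def by (intro conjI allI smoothC_intros; simp)+
  show ?thesis
    by (rule that[OF _ d_phi_comp_sph[OF f(1), folded f(2)]])
      (intro chart_smooth_diff chart_smooth_mult longitude sphere_fun_chart_smooth
        sphere_fun_ambient_deriv f)
qed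

section \<open>The Lie bracket of stream fields\<close>

lemma chart_eq_box: "chart = box (0, 0) (pi, 2 * pi)"
  by (auto simp: chart_def box_def Basis_prod_def)

lemma open_chart: "open chart"
  unfolding chart_eq_box by (rule open_box)

lemma closure_chart: "closure chart = cbox (0, 0) (pi, 2 * pi)"
proof -
  have "(pi / 2, pi) \<in> chart" by (simp add: chart_def)
  then show ?thesis unfolding chart_eq_box by (intro closure_box) auto
qed

lemma sin_chart_pos: "p \<in> chart \<Longrightarrow> 0 < sin (fst p)"
  by (auto simp: chart_def intro: sin_gt_zero)

lemma sn_nonzero: "p \<in> chart \<Longrightarrow> sn p \<noteq> 0"
  using sin_chart_pos by fastforce

definition chart_eq :: "(real \<times> real \<Rightarrow> 'a) \<Rightarrow> (real \<times> real \<Rightarrow> 'a) \<Rightarrow> bool" where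
  "chart_eq X Y \<longleftrightarrow> (\<forall>p\<in>chart. X p = Y p)"

lemma chart_eqI: "(\<And>p. p \<in> chart \<Longrightarrow> X p = Y p) \<Longrightarrow> chart_eq X Y"
  and chart_eq_refl [simp]: "chart_eq X X"
  and chart_eq_sym: "chart_eq X Y \<Longrightarrow> chart_eq Y X"
  and chart_eq_trans [trans]: "chart_eq X Y \<Longrightarrow> chart_eq Y Z \<Longrightarrow> chart_eq X Z"
  by (auto simp: chart_eq_def)

lemma vector_derivative_chart_cong:
  assumes "chart_eq F H" "continuous_on UNIV \<gamma>" "\<gamma> t \<in> chart"
  shows "vector_derivative (\<lambda>s. F (\<gamma> s)) (at t) = vector_derivative (\<lambda>s. H (\<gamma> s)) (at t)"
proof (rule vector_derivative_cong_eq)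
  have "eventually (\<lambda>s. s \<in> \<gamma> -` chart) (nhds t)"
    using assms by (intro eventually_nhds_in_open open_vimage open_chart) simp_all
  then show "eventually (\<lambda>s. s \<in> UNIV \<longrightarrow> F (\<gamma> s) = H (\<gamma> s)) (nhds t)"
    by eventually_elim (use assms in \<open>auto simp: chart_eq_def\<close>)
qed auto

lemma d_theta_chart_cong: "chart_eq F H \<Longrightarrow> p \<in> chart \<Longrightarrow> d_theta F p = d_theta H p"
  unfolding d_theta_def by (intro vector_derivative_chart_cong) (auto intro: continuous_intros)

lemma d_phi_chart_cong: "chart_eq F H \<Longrightarrow> p \<in> chart \<Longrightarrow> d_phi F p = d_phi H p"
  unfolding d_phi_def by (intro vector_derivative_chart_cong) (auto intro: continuous_intros)

lemma sgrad_chart_cong: "chart_eq F H \<Longrightarrow> chart_eq (sgrad F) (sgrad H)"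
  by (auto simp: chart_eq_def[of "sgrad _"] sgrad_def d_theta_chart_cong d_phi_chart_cong)

lemma vadd_chart_cong: "chart_eq X X' \<Longrightarrow> chart_eq Y Y' \<Longrightarrow> chart_eq (vadd X Y) (vadd X' Y')"
  and vscale_chart_cong: "chart_eq X X' \<Longrightarrow> chart_eq (vscale c X) (vscale c X')"
  and vsub_chart_cong: "chart_eq X X' \<Longrightarrow> chart_eq Y Y' \<Longrightarrow> chart_eq (vsub X Y) (vsub X' Y')"
  by (auto simp: chart_eq_def vadd_def vscale_def vsub_def)

lemma lie_chart_cong:
  assumes "chart_eq X X'" "chart_eq Y Y'"
  shows "chart_eq (lie X Y) (lie X' Y')"
proof -
  have "chart_eq (\<lambda>p. fst (X p)) (\<lambda>p. fst (X' p))" "chart_eq (\<lambda>p. fst (Y p)) (\<lambda>p. fst (Y' p))"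
    "chart_eq (\<lambda>p. snd (X p)) (\<lambda>p. snd (X' p))" "chart_eq (\<lambda>p. snd (Y p)) (\<lambda>p. snd (Y' p))"
    using assms by (auto simp: chart_eq_def)
  note this[THEN d_theta_chart_cong] this[THEN d_phi_chart_cong]
  then show ?thesis
    using assms by (auto simp: chart_eq_def lie_def dir_der_def)
qed

lemma bil_chart_cong: "chart_eq X X' \<Longrightarrow> chart_eq Y Y' \<Longrightarrow> bil X Y = bil X' Y'"
  unfolding bil_def by (intro set_lebesgue_integral_cong) (auto simp: open_chart chart_eq_def)

lemma herm_chart_cong: "chart_eq X X' \<Longrightarrow> chart_eq Y Y' \<Longrightarrow> herm X Y = herm X' Y'"
  unfolding herm_def by (intro set_lebesgue_integral_cong) (auto simp: open_chart chart_eq_def)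

lemma Bop_chart_cong:
  assumes "chart_eq X X'" "chart_eq Y Y'"
  shows "Bop X Y = Bop X' Y'"
proof -
  have "bil X (lie Y w) = bil X' (lie Y' w)" for w
    using assms by (intro bil_chart_cong lie_chart_cong) simp_all
  then show ?thesis by (simp add: Bop_def)
qed

lemma nabla_chart_cong: "chart_eq X X' \<Longrightarrow> chart_eq Y Y' \<Longrightarrow> chart_eq (nabla X Y) (nabla X' Y')"
  unfolding nabla_def
  by (auto intro!: vscale_chart_cong vsub_chart_cong lie_chart_cong simp: Bop_chart_cong[of X X' Y Y']
    Bop_chart_cong[of Y Y' X X'])

lemma sec_curv_chart_cong:
  assumes "chart_eq X X'" "chart_eq Y Y'"
  shows "sec_curv X Y = sec_curv X' Y'"
proof -
  have "chart_eq (Rcurv X Y X) (Rcurv X' Y' X')"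
    unfolding Rcurv_def
    by (intro vadd_chart_cong vscale_chart_cong nabla_chart_cong lie_chart_cong assms)
  then show ?thesis
    using herm_chart_cong assms unfolding sec_curv_def by metis
qed

lemma vadd_zero: "vadd X (\<lambda>p. (0, 0)) = X"
  by (simp add: vadd_def fun_eq_iff)

lemma sgrad_const: "sgrad (\<lambda>p. c) = (\<lambda>p. (0, 0))"
  by (simp add: sgrad_def d_theta_simps d_phi_simps fun_eq_iff)

lemma sgrad_add: "chart_smooth F \<Longrightarrow> chart_smooth H \<Longrightarrow> sgrad (\<lambda>p. F p + H p) = vadd (sgrad F) (sgrad H)"
  by (simp add: sgrad_def vadd_def d_theta_simps d_phi_simps fun_eq_iff add_divide_distrib
    diff_divide_distrib)

lemma sgrad_cmult: "chart_smooth F \<Longrightarrow> sgrad (\<lambda>p. c * F p) = vscale c (sgrad F)"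
  by (simp add: sgrad_def vscale_def d_theta_simps d_phi_simps fun_eq_iff chart_smooth_const)

lemma sgrad_diff:
  assumes "chart_smooth F" "chart_smooth H"
  shows "sgrad (\<lambda>p. F p - H p) = vsub (sgrad F) (sgrad H)"
  using sgrad_add[OF assms(1) chart_smooth_uminus[OF assms(2)]] sgrad_cmult[OF assms(2), of "-1"]
  by (simp add: vsub_def)

lemma sgrad_cnj:
  "chart_smooth F \<Longrightarrow> sgrad (\<lambda>p. cnj (F p)) = (\<lambda>p. (cnj (fst (sgrad F p)), cnj (snd (sgrad F p))))"
  by (simp add: sgrad_def d_theta_simps d_phi_simps fun_eq_iff)

lemma d_theta_div_sn:
  assumes "chart_smooth F" "p \<in> chart"
  shows "d_theta (\<lambda>q. F q / sn q) p = d_theta F p / sn p - F p * cs p / (sn p)\<^sup>2"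
proof -
  obtain a b where p: "p = (a, b)" by fastforce
  have s: "sin a \<noteq> 0" using sn_nonzero[OF assms(2)] p by simp
  have "((\<lambda>t. of_real (inverse (sin t)))
      has_vector_derivative complex_of_real (- cos a / (sin a)\<^sup>2)) (at a)"
    using s by (intro has_vector_derivative_of_real)
      (auto intro!: derivative_eq_intros simp: divide_simps power2_eq_square)
  from has_vector_derivative_mult[OF chart_smooth_has_d_theta[OF assms(1), of b a] this]
  have "((\<lambda>t. F (t, b) / of_real (sin t)) has_vector_derivative
     F (a, b) * complex_of_real (- cos a / (sin a)\<^sup>2)
     + d_theta F (a, b) * of_real (inverse (sin a))) (at a)"
    by (simp add: divide_inverse of_real_inverse)
  from vector_derivative_at[OF this] show ?thesis
    by (simp add: p d_theta_def divide_simps)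
qed

lemma d_phi_div_sn:
  assumes "chart_smooth F"
  shows "d_phi (\<lambda>q. F q / sn q) p = d_phi F p / sn p"
proof -
  obtain a b where p: "p = (a, b)" by fastforce
  have "((\<lambda>t. F (a, t)) has_vector_derivative d_phi F (a, b)) (at b)"
    by (rule chart_smooth_has_d_phi[OF assms])
  from vector_derivative_at[OF has_vector_derivative_divide[OF this, of "of_real (sin a)"]]
  show ?thesis by (simp add: p d_phi_def)
qed

definition poisson :: "(real \<times> real \<Rightarrow> complex) \<Rightarrow> (real \<times> real \<Rightarrow> complex) \<Rightarrow> real \<times> real \<Rightarrow> complex" where
  "poisson g h = dir_der (sgrad g) h"

lemma poisson_eq: "poisson g h p = (d_phi g p * d_theta h p - d_theta g p * d_phi h p) / sn p"
  by (simp add: poisson_def dir_der_def sgrad_def diff_divide_distrib)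

lemma sgrad_deriv_simps:
  assumes "chart_smooth g" "p \<in> chart"
  shows "d_theta (\<lambda>q. fst (sgrad g q)) p = d_theta (d_phi g) p / sn p - d_phi g p * cs p / (sn p)\<^sup>2"
    "d_theta (\<lambda>q. snd (sgrad g q)) p = - d_theta (d_theta g) p / sn p + d_theta g p * cs p / (sn p)\<^sup>2"
    "d_phi (\<lambda>q. fst (sgrad g q)) p = d_phi (d_phi g) p / sn p"
    "d_phi (\<lambda>q. snd (sgrad g q)) p = - d_theta (d_phi g) p / sn p"
  using assms d_theta_div_sn[of "\<lambda>q. - d_theta g q" p] d_phi_div_sn[of "\<lambda>q. - d_theta g q" p]
  by (simp_all add: sgrad_def d_theta_div_sn d_phi_div_sn chart_smooth_rules d_theta_simps d_phi_simps)

lemma lie_sgrad: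
  assumes "chart_smooth g" "chart_smooth h"
  shows "chart_eq (lie (sgrad g) (sgrad h)) (sgrad (poisson g h))"
proof (rule chart_eqI)
  fix p assume p: "p \<in> chart"
  let ?N = "\<lambda>p. d_phi g p * d_theta h p - d_theta g p * d_phi h p"
  have N: "chart_smooth ?N" by (intro chart_smooth_rules assms)
  have N_deriv: "d_theta ?N p = d_phi g p * d_theta (d_theta h) p + d_theta (d_phi g) p * d_theta h p
      - (d_theta g p * d_theta (d_phi h) p + d_theta (d_theta g) p * d_phi h p)"
    "d_phi ?N p = d_phi g p * d_theta (d_phi h) p + d_phi (d_phi g) p * d_theta h p
      - (d_theta g p * d_phi (d_phi h) p + d_theta (d_phi g) p * d_phi h p)"
    using assms by (simp_all add: d_theta_simps d_phi_simps chart_smooth_rules)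
  have "poisson g h = (\<lambda>p. ?N p / sn p)" by (simp add: poisson_eq fun_eq_iff)
  then have "d_theta (poisson g h) p = d_theta ?N p / sn p - ?N p * cs p / (sn p)\<^sup>2"
    "d_phi (poisson g h) p = d_phi ?N p / sn p"
    by (simp_all only: d_theta_div_sn[OF N p] d_phi_div_sn[OF N])
  then have "sgrad (poisson g h) p = (d_phi ?N p / (sn p)\<^sup>2, - d_theta ?N p / (sn p)\<^sup>2
      + ?N p * cs p / (sn p) ^ 3)"
    by (simp add: sgrad_def diff_divide_distrib power2_eq_square power3_eq_cube)
  then show "lie (sgrad g) (sgrad h) p = sgrad (poisson g h) p"
    unfolding lie_def dir_der_def sgrad_deriv_simps[OF assms(1) p]
      sgrad_deriv_simps[OF assms(2) p] N_deriv
    by (simp add: sgrad_def divide_inverse power2_eq_square power3_eq_cube algebra_simps)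
qed

lemma sn_mult_poisson: "p \<in> chart \<Longrightarrow>
    sn p * poisson g h p = d_phi g p * d_theta h p - d_theta g p * d_phi h p"
  using sn_nonzero[of p] by (simp add: poisson_eq)

lemma poisson_self: "poisson g g p = 0"
  by (simp add: poisson_eq)

lemma poisson_commute: "poisson h g p = - poisson g h p"
  by (simp add: poisson_eq minus_divide_left)

lemma poisson_add: "chart_smooth h \<Longrightarrow> chart_smooth k \<Longrightarrow>
    poisson g (\<lambda>p. h p + k p) p = poisson g h p + poisson g k p"
  by (simp add: poisson_eq d_theta_simps d_phi_simps algebra_simps diff_divide_distrib
    add_divide_distrib)

lemma poisson_mult: "chart_smooth h \<Longrightarrow> chart_smooth k \<Longrightarrow>
    poisson g (\<lambda>p. h p * k p) p = h p * poisson g k p + poisson g h p * k p"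
  by (simp add: poisson_eq d_theta_simps d_phi_simps algebra_simps diff_divide_distrib
    add_divide_distrib)

lemma poisson_const: "poisson g (\<lambda>p. c) p = 0"
  by (simp add: poisson_eq d_theta_simps d_phi_simps)

lemma poisson_cmult: "chart_smooth h \<Longrightarrow> poisson g (\<lambda>p. c * h p) p = c * poisson g h p"
  by (simp add: poisson_mult poisson_const chart_smooth_const)

lemma poisson_sum:
  "(\<And>i. i \<in> A \<Longrightarrow> sphere_fun (h i)) \<Longrightarrow> poisson g (\<lambda>p. \<Sum>i\<in>A. h i p) p = (\<Sum>i\<in>A. poisson g (h i) p)"
  by (induction A rule: infinite_finite_induct)
    (simp_all add: poisson_const poisson_add sphere_fun_chart_smooth sphere_fun_sum)

lemma poisson_cmult_left: "chart_smooth g \<Longrightarrow> poisson (\<lambda>p. c * g p) h p = c * poisson g h p"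
  using poisson_cmult[of g h c p] by (simp add: poisson_commute[of _ h])

text \<open>On the unit sphere the bracket of ambient functions is the triple product
  \<open>- x \<bullet> (\<nabla>f \<times> \<nabla>f')\<close>.\<close>
lemma sphere_fun_poisson:
  assumes "sphere_fun g" "sphere_fun h"
  obtains k where "sphere_fun k" "chart_eq (poisson g h) k"
proof -
  obtain f f' where f: "smoothC f" "g = (\<lambda>p. f (sph p))" "smoothC f'" "h = (\<lambda>p. f' (sph p))"
    using assms by (auto simp: sphere_fun_def)
  let ?C = "\<lambda>p. of_real (cos (snd p)) :: complex" and ?S = "\<lambda>p. of_real (sin (snd p)) :: complex"
  let ?x = "ambient_deriv f (1, 0, 0)" and ?y = "ambient_deriv f (0, 1, 0)"
    and ?z = "ambient_deriv f (0, 0, 1)"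
  let ?x' = "ambient_deriv f' (1, 0, 0)" and ?y' = "ambient_deriv f' (0, 1, 0)"
    and ?z' = "ambient_deriv f' (0, 0, 1)"
  define k where "k p = (sn p * ?C p) * (?z p * ?y' p - ?y p * ?z' p)
    + (sn p * ?S p) * (?x p * ?z' p - ?z p * ?x' p) + cs p * (?y p * ?x' p - ?x p * ?y' p)" for p
  have "sphere_fun k"
    unfolding k_def[abs_def] by (intro sphere_fun_intros sphere_fun_ambient_deriv f)
  moreover have "chart_eq (poisson g h) k"
  proof (rule chart_eqI)
    fix p assume p: "p \<in> chart"
    have trig: "?C p * ?C p + ?S p * ?S p = 1"
      by (simp flip: of_real_mult of_real_add)
    have "poisson g h p = (?C p * ?y p - ?S p * ?x p)
          * (cs p * (?C p * ?x' p + ?S p * ?y' p) - sn p * ?z' p)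
        - (cs p * (?C p * ?x p + ?S p * ?y p) - sn p * ?z p) * (?C p * ?y' p - ?S p * ?x' p)"
      using sn_nonzero[OF p]
      unfolding poisson_eq f(2,4) d_theta_comp_sph[OF f(1)] d_theta_comp_sph[OF f(3)]
        d_phi_comp_sph[OF f(1)] d_phi_comp_sph[OF f(3)]
      by (simp add: divide_eq_eq right_diff_distrib left_diff_distrib mult_ac)
    also have "\<dots> = k p"
      unfolding k_def using trig by algebra
    finally show "poisson g h p = k p" .
  qed
  ultimately show ?thesis using that by blast
qed

section \<open>Integration over the sphere\<close>

definition chart_int :: "(real \<times> real \<Rightarrow> complex) \<Rightarrow> complex" where
  "chart_int F = integral (cbox (0, 0) (pi, 2 * pi)) F"

definition sphere_int :: "(real \<times> real \<Rightarrow> complex) \<Rightarrow> complex" where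
  "sphere_int F = chart_int (\<lambda>p. sn p * F p)"

lemma chart_int_cong: "chart_eq F H \<Longrightarrow> chart_int F = chart_int H"
  unfolding chart_int_def integral_open_interval[symmetric] chart_eq_box[symmetric] chart_eq_def
  by (rule integral_cong) blast

lemma chart_lint_eq:
  assumes F: "chart_smooth F" and "chart_eq H F"
  shows "(LINT p : chart | lborel. H p) = chart_int F"
proof -
  have "set_integrable lborel (cbox (0, 0) (pi, 2 * pi)) F"
    unfolding set_integrable_def
    by (intro borel_integrable_compact compact_cbox chart_smooth_continuous_on F)
  then have "set_integrable lborel chart F"
    by (rule set_integrable_subset) (use closure_subset closure_chart open_chart in auto)
  then have "(LINT p : chart | lborel. F p) = chart_int F"
    by (simp add: set_borel_integral_eq_integral chart_eq_box integral_open_interval chart_int_def)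
  moreover have "(LINT p : chart | lborel. H p) = (LINT p : chart | lborel. F p)"
    using assms(2) by (intro set_lebesgue_integral_cong) (auto simp: open_chart chart_eq_def)
  ultimately show ?thesis by simp
qed

lemma chart_int_iterated:
  assumes "chart_smooth F"
  shows "chart_int F = integral {0..pi} (\<lambda>x. integral {0..2 * pi} (\<lambda>y. F (x, y)))"
  unfolding chart_int_def using integral_prod_continuous[OF chart_smooth_continuous_on[OF assms]] by simp

lemma chart_int_d_theta:
  assumes P: "chart_smooth P" and poles: "\<And>y. P (0, y) = 0" "\<And>y. P (pi, y) = 0"
  shows "chart_int (d_theta P) = 0"
proof -
  have "continuous_on (cbox (0, 0) (pi, 2 * pi)) (\<lambda>(x, y). d_theta P (x, y))"
    using chart_smooth_continuous_on[OF chart_smooth_d_theta[OF P]] by simp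
  from integral_swap_continuous[OF this]
  have "chart_int (d_theta P) = integral {0..2 * pi} (\<lambda>y. integral {0..pi} (\<lambda>x. d_theta P (x, y)))"
    by (simp add: chart_int_iterated chart_smooth_d_theta P)
  also have "(\<lambda>y. integral {0..pi} (\<lambda>x. d_theta P (x, y))) = (\<lambda>y. P (pi, y) - P (0, y))"
    by (rule ext, rule integral_unique, rule fundamental_theorem_of_calculus[where
        f = "\<lambda>x. P (x, y)" for y])
      (simp_all add: has_vector_derivative_at_within chart_smooth_has_d_theta[OF P])
  finally show ?thesis by (simp add: poles)
qed

lemma chart_int_d_phi:
  assumes P: "chart_smooth P"
  shows "chart_int (d_phi P) = 0"
proof -
  have "chart_int (d_phi P) = integral {0..pi} (\<lambda>x. integral {0..2 * pi} (\<lambda>y. d_phi P (x, y)))"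
    by (rule chart_int_iterated[OF chart_smooth_d_phi[OF P]])
  also have "(\<lambda>x. integral {0..2 * pi} (\<lambda>y. d_phi P (x, y))) = (\<lambda>x. P (x, 2 * pi) - P (x, 0))"
    by (rule ext, rule integral_unique, rule fundamental_theorem_of_calculus[where
        f = "\<lambda>y. P (x, y)" for x])
      (simp_all add: has_vector_derivative_at_within chart_smooth_has_d_phi[OF P])
  finally show ?thesis using chart_smooth_periodic[OF P, of _ 0] by simp
qed

lemma chart_smooth_integrable: "chart_smooth F \<Longrightarrow> F integrable_on cbox (0, 0) (pi, 2 * pi)"
  by (intro integrable_continuous chart_smooth_continuous_on)

lemma chart_int_add:
  "chart_smooth F \<Longrightarrow> chart_smooth H \<Longrightarrow> chart_int (\<lambda>p. F p + H p) = chart_int F + chart_int H"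
  unfolding chart_int_def by (intro integral_add chart_smooth_integrable)

lemma chart_int_divergence:
  assumes "chart_smooth P" "chart_smooth Q" "\<And>y. P (0, y) = 0" "\<And>y. P (pi, y) = 0"
  shows "chart_int (\<lambda>p. d_theta P p + d_phi Q p) = 0"
  using assms by (simp add: chart_int_add chart_smooth_rules chart_int_d_theta chart_int_d_phi)

lemma sphere_int_cong: "chart_eq F H \<Longrightarrow> sphere_int F = sphere_int H"
  unfolding sphere_int_def by (rule chart_int_cong) (simp add: chart_eq_def)

lemma sphere_int_add:
  "chart_smooth F \<Longrightarrow> chart_smooth H \<Longrightarrow> sphere_int (\<lambda>p. F p + H p) = sphere_int F + sphere_int H"
  by (simp add: sphere_int_def distrib_left chart_int_add chart_smooth_rules)

lemma sphere_int_cmult: "sphere_int (\<lambda>p. c * F p) = c * sphere_int F"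
  by (simp add: sphere_int_def chart_int_def mult.left_commute[of _ c])

lemma sphere_int_diff:
  assumes "chart_smooth F" "chart_smooth H"
  shows "sphere_int (\<lambda>p. F p - H p) = sphere_int F - sphere_int H"
  using sphere_int_add[OF assms(1) chart_smooth_uminus[OF assms(2)]] sphere_int_cmult[of "-1" H] by simp

lemma sphere_int_sum:
  "(\<And>i. i \<in> A \<Longrightarrow> chart_smooth (F i)) \<Longrightarrow> sphere_int (\<lambda>p. \<Sum>i\<in>A. F i p) = (\<Sum>i\<in>A. sphere_int (F i))"
proof (induction A rule: infinite_finite_induct)
  case (insert i A)
  then show ?case by (simp add: sphere_int_add chart_smooth_sum)
qed (simp_all add: sphere_int_def chart_int_def)

lemma sphere_int_poisson:
  assumes g: "sphere_fun g" and h: "chart_smooth h"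
  shows "sphere_int (poisson g h) = 0"
proof -
  note smooth = sphere_fun_chart_smooth[OF g]
  obtain G where G: "d_phi g = (\<lambda>p. sn p * G p)"
    using sphere_fun_d_phi[OF g] .
  have "sphere_int (poisson g h)
      = chart_int (\<lambda>p. d_theta (\<lambda>p. d_phi g p * h p) p + d_phi (\<lambda>p. - (d_theta g p * h p)) p)"
    unfolding sphere_int_def
  proof (intro chart_int_cong chart_eqI)
    fix p assume p: "p \<in> chart"
    show "sn p * poisson g h p = d_theta (\<lambda>p. d_phi g p * h p) p + d_phi (\<lambda>p. - (d_theta g p * h p)) p"
      unfolding sn_mult_poisson[OF p]
      by (simp add: d_theta_simps d_phi_simps chart_smooth_rules smooth h algebra_simps)
  qed
  also have "\<dots> = 0"
    by (intro chart_int_divergence chart_smooth_rules smooth h) (simp_all add: G)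
  finally show ?thesis .
qed

text \<open>Where \<open>sin \<theta> = 0\<close>, the chart formula for the bracket has the junk value of a division by zero; hence
  the smooth representatives \<open>k\<close> and \<open>c\<close>.\<close>
lemma sphere_int_poisson_by_parts:
  assumes g: "sphere_fun g" and h: "chart_smooth h" "chart_smooth b"
    and k: "chart_smooth k" "chart_eq k (poisson g h)" and c: "chart_smooth c" "chart_eq c (poisson g b)"
  shows "sphere_int (\<lambda>p. b p * k p) = - sphere_int (\<lambda>p. c p * h p)"
proof -
  have "sphere_int (\<lambda>p. b p * k p) + sphere_int (\<lambda>p. c p * h p) = sphere_int (\<lambda>p. b p * k p + c p * h p)"
    by (intro sphere_int_add[symmetric] chart_smooth_rules h k c)
  also have "\<dots> = sphere_int (poisson g (\<lambda>p. b p * h p))"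
    using k c by (intro sphere_int_cong) (simp add: chart_eq_def poisson_mult h)
  also have "\<dots> = 0"
    by (intro sphere_int_poisson g chart_smooth_rules h)
  finally show ?thesis by (simp add: eq_neg_iff_add_eq_0)
qed

lemma sphere_int_nonneg_eq_0:
  fixes r :: "real \<times> real \<Rightarrow> real"
  assumes F: "chart_smooth (\<lambda>p. of_real (r p))" and nonneg: "\<And>p. 0 \<le> r p"
    and "sphere_int (\<lambda>p. of_real (r p)) = 0" and p: "p \<in> chart"
  shows "r p = 0"
proof -
  let ?B = "cbox (0, 0) (pi, 2 * pi)" and ?F = "\<lambda>p. complex_of_real (sin (fst p) * r p)"
  have smooth: "chart_smooth ?F"
    unfolding of_real_mult by (intro chart_smooth_rules F)
  then have cont: "continuous_on ?B (\<lambda>p. Re (?F p))"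
    by (intro continuous_intros chart_smooth_continuous_on)
  have "integral ?B (\<lambda>p. Re (?F p)) = Re (integral ?B ?F)"
    using integral_linear[OF chart_smooth_integrable[OF smooth] bounded_linear_Re] by (simp add: o_def)
  also have "\<dots> = 0"
    using assms(3) by (simp add: sphere_int_def chart_int_def)
  finally have zero: "((\<lambda>p. Re (?F p)) has_integral 0) ?B"
    using integrable_continuous[OF cont] by (metis has_integral_integral)
  have "0 \<le> Re (?F q)" if "q \<in> box (0, 0) (pi, 2 * pi)" for q
    using that nonneg less_imp_le[OF sin_chart_pos] by (simp flip: chart_eq_box)
  moreover have "p \<in> ?B"
    using p closure_subset[of chart] closure_chart by blast
  moreover have "box (0, 0) (pi, 2 * pi) \<noteq> {}"
    using p by (auto simp flip: chart_eq_box)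
  ultimately have "Re (?F p) = 0"
    by (intro has_integral_0_cbox_imp_0[OF cont _ zero])
  then show ?thesis
    using sin_chart_pos[OF p] by simp
qed

section \<open>Nondegeneracy of the metric on stream fields\<close>

lemma bil_sgrad:
  assumes "sphere_fun f" "sphere_fun g" "chart_smooth F" "chart_smooth G"
    and "d_phi f = (\<lambda>p. sn p * F p)" "d_phi g = (\<lambda>p. sn p * G p)"
  shows "bil (sgrad f) (sgrad g) = sphere_int (\<lambda>p. F p * G p + d_theta f p * d_theta g p)"
  unfolding bil_def sphere_int_def
proof (rule chart_lint_eq)
  show "chart_smooth (\<lambda>p. sn p * (F p * G p + d_theta f p * d_theta g p))"
    by (intro chart_smooth_rules assms sphere_fun_chart_smooth)
  show "chart_eq (\<lambda>p. (fst (sgrad f p) * fst (sgrad g p)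
      + complex_of_real ((sin (fst p))\<^sup>2) * snd (sgrad f p) * snd (sgrad g p)) * sn p)
      (\<lambda>p. sn p * (F p * G p + d_theta f p * d_theta g p))"
    by (rule chart_eqI, drule sn_nonzero) (simp add: sgrad_def assms field_simps power2_eq_square)
qed

lemma bil_sgrad_diff:
  assumes "sphere_fun f" "sphere_fun f'" "sphere_fun g"
  shows "bil (sgrad (\<lambda>p. f p - f' p)) (sgrad g) = bil (sgrad f) (sgrad g) - bil (sgrad f') (sgrad g)"
proof -
  obtain F where F: "chart_smooth F" "d_phi f = (\<lambda>p. sn p * F p)"
    using sphere_fun_d_phi[OF assms(1)] .
  obtain F' where F': "chart_smooth F'" "d_phi f' = (\<lambda>p. sn p * F' p)"
    using sphere_fun_d_phi[OF assms(2)] .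
  obtain G where G: "chart_smooth G" "d_phi g = (\<lambda>p. sn p * G p)"
    using sphere_fun_d_phi[OF assms(3)] .
  note smooth = assms[THEN sphere_fun_chart_smooth]
  have "bil (sgrad (\<lambda>p. f p - f' p)) (sgrad g) =
      sphere_int (\<lambda>p. (F p - F' p) * G p + d_theta (\<lambda>p. f p - f' p) p * d_theta g p)"
    by (intro bil_sgrad sphere_fun_diff assms chart_smooth_diff F F' G)
      (simp add: d_phi_simps smooth F F' algebra_simps)
  also have "\<dots> = sphere_int (\<lambda>p. (F p * G p + d_theta f p * d_theta g p)
      - (F' p * G p + d_theta f' p * d_theta g p))"
    by (simp add: d_theta_simps smooth algebra_simps)
  also have "\<dots> = bil (sgrad f) (sgrad g) - bil (sgrad f') (sgrad g)"
    unfolding bil_sgrad[OF assms(1,3) F(1) G(1) F(2) G(2)] bil_sgrad[OF assms(2,3) F'(1) G(1) F'(2) G(2)]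
    by (intro sphere_int_diff chart_smooth_rules smooth F F' G)
  finally show ?thesis .
qed

lemma herm_sgrad_eq_bil: "chart_smooth g \<Longrightarrow> herm X (sgrad g) = bil X (sgrad (\<lambda>p. cnj (g p)))"
  by (simp add: herm_def bil_def sgrad_cnj)

lemma sph_surj_on_closure_chart:
  obtains q where "q \<in> closure chart" "sph q = sph p"
proof -
  obtain a b where p: "p = (a, b)" by fastforce
  let ?th = "arccos (cos a)"
  have th: "0 \<le> ?th" "?th \<le> pi" "cos ?th = cos a"
    by (simp_all add: arccos_lbound arccos_ubound)
  have "(sin ?th)\<^sup>2 = (sin a)\<^sup>2"
    by (metis sin_squared_eq th(3))
  then obtain e :: real where e: "e\<^sup>2 = 1" "sin ?th = e * sin a"
    by (auto simp: power2_eq_iff intro: that[of 1] that[of "-1"])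
  have "(e * cos b)\<^sup>2 + (e * sin b)\<^sup>2 = 1"
    by (simp add: power_mult_distrib e)
  then obtain t where t: "0 \<le> t" "t < 2 * pi" "e * cos b = cos t" "e * sin b = sin t"
    using sincos_total_2pi by metis
  have "sph (?th, t) = sph p"
    using e(1) by (simp add: p sph_def th e(2) power2_eq_square flip: t(3,4))
  moreover have "(?th, t) \<in> closure chart"
    using th t by (simp add: closure_chart)
  ultimately show ?thesis using that by blast
qed

lemma sphere_fun_eq_const:
  assumes g: "sphere_fun g" and c: "\<And>p. p \<in> chart \<Longrightarrow> g p = c"
  shows "g = (\<lambda>p. c)"
proof
  fix p
  obtain q where q: "q \<in> closure chart" "sph q = sph p"
    by (rule sph_surj_on_closure_chart)
  have "g ` closure chart \<subseteq> {c}"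
    using c
    by (intro image_closure_subset chart_smooth_continuous_on[OF sphere_fun_chart_smooth[OF g]]) auto
  moreover have "g p = g q"
    using g q(2) by (auto simp: sphere_fun_def)
  ultimately show "g p = c" using q(1) by auto
qed

lemma chart_smooth_constant_on_chart:
  assumes g: "chart_smooth g" and zero: "\<And>p. p \<in> chart \<Longrightarrow> d_theta g p = 0" "\<And>p. p \<in> chart \<Longrightarrow> d_phi g p = 0"
  shows "\<exists>c. \<forall>p\<in>chart. g p = c"
proof (rule has_derivative_zero_constant)
  show "convex chart"
    unfolding chart_eq_box by (rule convex_box)
  fix p assume p: "p \<in> chart"
  let ?D = "frechet_derivative g (at p)"
  note smooth = chart_smooth_imp_smoothC[OF g]
  have "?D v = 0" for v
  proof -
    have linear: "linear ?D"
      by (rule has_derivative_linear[OF smoothC_has_derivative[OF smooth]])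
    have "?D (fst v *\<^sub>R (1, 0) + snd v *\<^sub>R (0, 1)) = fst v *\<^sub>R ?D (1, 0) + snd v *\<^sub>R ?D (0, 1)"
      by (simp only: linear_add[OF linear] linear_scale[OF linear])
    then show ?thesis
      using zero[OF p]
      by (simp add: d_theta_eq_frechet_derivative[OF smooth] d_phi_eq_frechet_derivative[OF smooth])
  qed
  then have "?D = (\<lambda>v. 0)" by auto
  then show "(g has_derivative (\<lambda>v. 0)) (at p within chart)"
    using has_derivative_at_withinI[OF smoothC_has_derivative[OF smooth]] by metis
qed

lemma sgrad_eq_0_if_herm_0:
  assumes g: "sphere_fun g" and zero: "herm (sgrad g) (sgrad g) = 0"
  shows "sgrad g = (\<lambda>p. (0, 0))"
proof -
  note smooth = sphere_fun_chart_smooth[OF g]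
  obtain G where G: "chart_smooth G" "d_phi g = (\<lambda>p. sn p * G p)"
    using sphere_fun_d_phi[OF g] .
  let ?r = "\<lambda>p. (cmod (G p))\<^sup>2 + (cmod (d_theta g p))\<^sup>2"
  have r_eq: "(\<lambda>p. G p * cnj (G p) + d_theta g p * cnj (d_theta g p)) = (\<lambda>p. complex_of_real (?r p))"
    by (simp add: complex_norm_square del: of_real_power)
  have "herm (sgrad g) (sgrad g)
      = sphere_int (\<lambda>p. G p * cnj (G p) + d_theta g p * d_theta (\<lambda>p. cnj (g p)) p)"
    unfolding herm_sgrad_eq_bil[OF smooth]
    by (intro bil_sgrad g sphere_fun_cnj chart_smooth_cnj G) (simp add: d_phi_simps smooth G(2))
  then have int: "sphere_int (\<lambda>p. complex_of_real (?r p)) = 0"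
    unfolding r_eq[symmetric] using zero by (simp add: d_theta_simps smooth)
  have "chart_smooth (\<lambda>p. complex_of_real (?r p))"
    unfolding r_eq[symmetric] by (intro chart_smooth_rules smooth G)
  from sphere_int_nonneg_eq_0[OF this _ int] have "?r p = 0" if "p \<in> chart" for p
    using that by simp
  then have "d_theta g p = 0 \<and> d_phi g p = 0" if "p \<in> chart" for p
    using that by (simp add: G(2) add_nonneg_eq_0_iff)
  then obtain c where "\<forall>p\<in>chart. g p = c"
    using chart_smooth_constant_on_chart[OF smooth] by blast
  then have "g = (\<lambda>p. c)"
    by (intro sphere_fun_eq_const g) blast
  then show ?thesis by (simp add: sgrad_const)
qed

lemma Bop_eqI:
  assumes z: "sphere_fun z" and eq: "\<And>g. sphere_fun g \<Longrightarrow>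
      bil (sgrad z) (sgrad g) = bil u (lie v (sgrad g))"
  shows "Bop u v = sgrad z"
  unfolding Bop_def
proof (rule the_equality)
  show "sgrad z \<in> SVect \<and> (\<forall>w\<in>SVect. bil (sgrad z) w = bil u (lie v w))"
    using z eq by (auto simp: SVect_eq)
next
  fix y assume y: "y \<in> SVect \<and> (\<forall>w\<in>SVect. bil y w = bil u (lie v w))"
  then obtain a where a: "sphere_fun a" "y = sgrad a"
    by (auto simp: SVect_eq)
  define d where "d p = a p - z p" for p
  have d: "sphere_fun d"
    unfolding d_def[abs_def] by (intro sphere_fun_diff a z)
  then have cnj_d: "sphere_fun (\<lambda>p. cnj (d p))"
    by (rule sphere_fun_cnj)
  have "herm (sgrad d) (sgrad d) = bil (sgrad d) (sgrad (\<lambda>p. cnj (d p)))"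
    by (rule herm_sgrad_eq_bil[OF sphere_fun_chart_smooth[OF d]])
  also have "\<dots> = bil y (sgrad (\<lambda>p. cnj (d p))) - bil (sgrad z) (sgrad (\<lambda>p. cnj (d p)))"
    unfolding a(2) d_def[abs_def] using cnj_d by (intro bil_sgrad_diff a z) (simp add: d_def[abs_def])
  also have "\<dots> = 0"
    using y eq[OF cnj_d] cnj_d by (auto simp: SVect_eq)
  finally have "sgrad d = (\<lambda>p. (0, 0))"
    by (rule sgrad_eq_0_if_herm_0[OF d])
  moreover have "sgrad d = vsub y (sgrad z)"
    unfolding d_def[abs_def] a(2) by (intro sgrad_diff sphere_fun_chart_smooth a z)
  ultimately show "y = sgrad z"
    by (simp add: vsub_def vadd_def vscale_def fun_eq_iff prod_eq_iff)
qed

section \<open>The Laplacian and the operator B\<close>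

text \<open>\<open>has_laplacian f b\<close> is the equation \<open>\<Delta> f = b\<close>, multiplied by \<open>sin\<^sup>2 \<theta>\<close>.\<close>
definition has_laplacian :: "(real \<times> real \<Rightarrow> complex) \<Rightarrow> (real \<times> real \<Rightarrow> complex) \<Rightarrow> bool" where
  "has_laplacian f b \<longleftrightarrow> sphere_fun f \<and> sphere_fun b \<and>
     (\<forall>p. (sn p)\<^sup>2 * d_theta (d_theta f) p + sn p * cs p * d_theta f p + d_phi (d_phi f) p =
       (sn p)\<^sup>2 * b p)"

lemma has_laplacian_sphere_fun: "has_laplacian f b \<Longrightarrow> sphere_fun f" "has_laplacian f b \<Longrightarrow> sphere_fun b"
  by (auto simp: has_laplacian_def)

lemmas has_laplacian_chart_smooth = has_laplacian_sphere_fun[THEN sphere_fun_chart_smooth]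

lemma has_laplacianI:
  assumes "sphere_fun f" "sphere_fun b"
    and "\<And>p. (sn p)\<^sup>2 * d_theta (d_theta f) p + sn p * cs p * d_theta f p + d_phi (d_phi f) p
        = (sn p)\<^sup>2 * b p"
  shows "has_laplacian f b"
  unfolding has_laplacian_def using assms by blast

lemma has_laplacianD:
  assumes "has_laplacian f b"
  shows "(sn p)\<^sup>2 * d_theta (d_theta f) p + sn p * cs p * d_theta f p + d_phi (d_phi f) p
      = (sn p)\<^sup>2 * b p"
  using assms unfolding has_laplacian_def by blast

lemma has_laplacian_const: "has_laplacian (\<lambda>p. c) (\<lambda>p. 0)"
  by (intro has_laplacianI sphere_fun_const) (simp add: d_theta_simps d_phi_simps)

lemma has_laplacian_add:
  assumes f: "has_laplacian f b" and f': "has_laplacian f' b'"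
  shows "has_laplacian (\<lambda>p. f p + f' p) (\<lambda>p. b p + b' p)"
proof (rule has_laplacianI)
  fix p
  have "(sn p)\<^sup>2 * (d_theta (d_theta f) p + d_theta (d_theta f') p) + sn p * cs p * (d_theta f p + d_theta f' p)
      + (d_phi (d_phi f) p + d_phi (d_phi f') p) = (sn p)\<^sup>2 * (b p + b' p)"
    using has_laplacianD[OF f, of p] has_laplacianD[OF f', of p] by algebra
  then show "(sn p)\<^sup>2 * d_theta (d_theta (\<lambda>p. f p + f' p)) p + sn p * cs p * d_theta (\<lambda>p. f p + f' p) p
      + d_phi (d_phi (\<lambda>p. f p + f' p)) p = (sn p)\<^sup>2 * (b p + b' p)"
    by (simp add: d_theta_simps d_phi_simps chart_smooth_rules has_laplacian_chart_smooth[OF f]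
      has_laplacian_chart_smooth[OF f'])
qed (intro sphere_fun_add has_laplacian_sphere_fun[OF f] has_laplacian_sphere_fun[OF f'])+

lemma has_laplacian_cmult:
  assumes f: "has_laplacian f b"
  shows "has_laplacian (\<lambda>p. c * f p) (\<lambda>p. c * b p)"
proof (rule has_laplacianI)
  fix p
  have "(sn p)\<^sup>2 * (c * d_theta (d_theta f) p) + sn p * cs p * (c * d_theta f p) + c * d_phi (d_phi f) p
      = (sn p)\<^sup>2 * (c * b p)"
    using has_laplacianD[OF f, of p] by algebra
  then show "(sn p)\<^sup>2 * d_theta (d_theta (\<lambda>p. c * f p)) p + sn p * cs p * d_theta (\<lambda>p. c * f p) p
      + d_phi (d_phi (\<lambda>p. c * f p)) p = (sn p)\<^sup>2 * (c * b p)"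
    by (simp add: d_theta_simps d_phi_simps chart_smooth_rules has_laplacian_chart_smooth[OF f])
qed (intro sphere_fun_mult sphere_fun_const has_laplacian_sphere_fun[OF f])+

lemma has_laplacian_sum:
  "(\<And>i. i \<in> I \<Longrightarrow> has_laplacian (f i) (b i)) \<Longrightarrow> has_laplacian (\<lambda>p. \<Sum>i\<in>I. f i p) (\<lambda>p. \<Sum>i\<in>I. b i p)"
  by (induction I rule: infinite_finite_induct) (auto intro: has_laplacian_const has_laplacian_add)

lemma has_laplacian_cnj:
  assumes f: "has_laplacian f b"
  shows "has_laplacian (\<lambda>p. cnj (f p)) (\<lambda>p. cnj (b p))"
proof (rule has_laplacianI)
  fix p
  show "(sn p)\<^sup>2 * d_theta (d_theta (\<lambda>p. cnj (f p))) p + sn p * cs p * d_theta (\<lambda>p. cnj (f p)) p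
      + d_phi (d_phi (\<lambda>p. cnj (f p))) p = (sn p)\<^sup>2 * cnj (b p)"
    using arg_cong[OF has_laplacianD[OF f, of p], of cnj]
    by (simp add: d_theta_simps d_phi_simps chart_smooth_rules has_laplacian_chart_smooth[OF f])
qed (intro sphere_fun_cnj has_laplacian_sphere_fun[OF f])+

lemma has_laplacian_on_chart:
  assumes f: "has_laplacian f b" and F: "chart_smooth F" "d_phi f = (\<lambda>p. sn p * F p)" and p: "p \<in> chart"
  shows "sn p * d_theta (d_theta f) p + cs p * d_theta f p + d_phi F p = sn p * b p"
proof -
  have "d_phi (d_phi f) p = sn p * d_phi F p"
    unfolding F(2) by (simp add: d_phi_simps chart_smooth_rules F(1))
  then have "sn p * (sn p * d_theta (d_theta f) p + cs p * d_theta f p + d_phi F p)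
      = sn p * (sn p * b p)"
    using has_laplacianD[OF f, of p] by (simp add: power2_eq_square algebra_simps)
  then show ?thesis using sn_nonzero[OF p] by simp
qed

lemma green_identity:
  assumes f: "has_laplacian f b" and g: "sphere_fun g"
  shows "bil (sgrad f) (sgrad g) = - sphere_int (\<lambda>p. b p * g p)"
proof -
  note smooth = has_laplacian_chart_smooth[OF f] sphere_fun_chart_smooth[OF g]
  obtain F where F: "chart_smooth F" "d_phi f = (\<lambda>p. sn p * F p)"
    using sphere_fun_d_phi[OF has_laplacian_sphere_fun(1)[OF f]] .
  obtain G where G: "chart_smooth G" "d_phi g = (\<lambda>p. sn p * G p)"
    using sphere_fun_d_phi[OF g] .
  have "bil (sgrad f) (sgrad g) + sphere_int (\<lambda>p. b p * g p)
      = sphere_int (\<lambda>p. (F p * G p + d_theta f p * d_theta g p) + b p * g p)"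
    unfolding bil_sgrad[OF has_laplacian_sphere_fun(1)[OF f] g F(1) G(1) F(2) G(2)]
    by (intro sphere_int_add[symmetric] chart_smooth_rules smooth F G)
  also have "\<dots> = chart_int (\<lambda>p. d_theta (\<lambda>p. sn p * d_theta f p * g p) p + d_phi (\<lambda>p. F p * g p) p)"
    unfolding sphere_int_def
  proof (intro chart_int_cong chart_eqI)
    fix p assume p: "p \<in> chart"
    have "d_theta (\<lambda>p. sn p * d_theta f p * g p) p + d_phi (\<lambda>p. F p * g p) p
        = sn p * (F p * G p + d_theta f p * d_theta g p)
          + (sn p * d_theta (d_theta f) p + cs p * d_theta f p + d_phi F p) * g p"
      by (simp add: d_theta_simps d_phi_simps chart_smooth_rules smooth F(1) G(2) algebra_simps)
    also have "\<dots> = sn p * (F p * G p + d_theta f p * d_theta g p + b p * g p)"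
      unfolding has_laplacian_on_chart[OF f F p] by (simp add: algebra_simps)
    finally show "sn p * (F p * G p + d_theta f p * d_theta g p + b p * g p)
        = d_theta (\<lambda>p. sn p * d_theta f p * g p) p + d_phi (\<lambda>p. F p * g p) p"
      by (rule sym)
  qed
  also have "\<dots> = 0"
    by (intro chart_int_divergence chart_smooth_rules smooth F) simp_all
  finally show ?thesis by (simp add: eq_neg_iff_add_eq_0)
qed

lemma herm_sgrad:
  assumes "sphere_fun f" "has_laplacian g b"
  shows "herm (sgrad f) (sgrad g) = - sphere_int (\<lambda>p. f p * cnj (b p))"
proof -
  have "herm (sgrad f) (sgrad g) = bil (sgrad (\<lambda>p. cnj (g p))) (sgrad f)"
    unfolding herm_sgrad_eq_bil[OF has_laplacian_chart_smooth(1)[OF assms(2)]]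
    by (simp add: bil_def mult_ac)
  also have "\<dots> = - sphere_int (\<lambda>p. f p * cnj (b p))"
    unfolding green_identity[OF has_laplacian_cnj[OF assms(2)] assms(1)] by (simp add: mult.commute)
  finally show ?thesis .
qed

lemma Bop_sgrad:
  assumes f: "has_laplacian f b" and g: "sphere_fun g"
    and z: "has_laplacian z c" "chart_eq c (poisson b g)"
  shows "Bop (sgrad f) (sgrad g) = sgrad z"
proof (rule Bop_eqI)
  show "sphere_fun z" using has_laplacian_sphere_fun z(1) by blast
  fix h assume h: "sphere_fun h"
  obtain k where k: "sphere_fun k" "chart_eq (poisson g h) k"
    using sphere_fun_poisson[OF g h] .
  note smooth = has_laplacian_chart_smooth(2)[OF f] sphere_fun_chart_smooth[OF g]
    sphere_fun_chart_smooth[OF h] sphere_fun_chart_smooth[OF k(1)] has_laplacian_chart_smooth(2)[OF z(1)]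
  have "chart_eq (lie (sgrad g) (sgrad h)) (sgrad k)"
    using lie_sgrad[OF smooth(2,3)] sgrad_chart_cong[OF k(2)] by (rule chart_eq_trans)
  then have "bil (sgrad f) (lie (sgrad g) (sgrad h)) = bil (sgrad f) (sgrad k)"
    by (intro bil_chart_cong chart_eq_refl)
  also have "\<dots> = - sphere_int (\<lambda>p. b p * k p)"
    by (rule green_identity[OF f k(1)])
  also have "sphere_int (\<lambda>p. b p * k p) = - sphere_int (\<lambda>p. - c p * h p)"
    using g smooth k(2) z(2)
    by (intro sphere_int_poisson_by_parts[where g = g])
      (auto simp: chart_eq_def poisson_commute[of b] chart_smooth_rules)
  also have "\<dots> = sphere_int (\<lambda>p. c p * h p)"
    using sphere_int_cmult[of "-1" "\<lambda>p. c p * h p"] by simp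
  finally show "bil (sgrad z) (sgrad h) = bil (sgrad f) (lie (sgrad g) (sgrad h))"
    by (simp add: green_identity[OF z(1) h])
qed

section \<open>Curvature along an eigenfield\<close>

lemma herm_sgrad_eigenfunction:
  assumes "sphere_fun f" "has_laplacian g (\<lambda>p. - of_real \<mu> * g p)"
  shows "herm (sgrad f) (sgrad g) = of_real \<mu> * sphere_int (\<lambda>p. f p * cnj (g p))"
  using herm_sgrad[OF assms] sphere_int_cmult[of "- of_real \<mu>" "\<lambda>p. f p * cnj (g p)"]
  by (simp add: mult_ac)

lemma eigenfunctions_orthogonal:
  assumes f: "has_laplacian f (\<lambda>p. - of_real \<nu> * f p)" and g: "has_laplacian g (\<lambda>p. - of_real \<mu> * g p)"
    and "\<nu> \<noteq> \<mu>"
  shows "sphere_int (\<lambda>p. f p * cnj (g p)) = 0"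
proof -
  let ?S = "sphere_int (\<lambda>p. f p * cnj (g p))"
  have "of_real \<mu> * ?S = herm (sgrad f) (sgrad g)"
    by (rule herm_sgrad_eigenfunction[OF has_laplacian_sphere_fun(1)[OF f] g, symmetric])
  also have "\<dots> = - sphere_int (\<lambda>p. - of_real \<nu> * f p * cnj (g p))"
    unfolding herm_sgrad_eq_bil[OF has_laplacian_chart_smooth(1)[OF g]]
    by (rule green_identity[OF f sphere_fun_cnj[OF has_laplacian_sphere_fun(1)[OF g]]])
  also have "\<dots> = of_real \<nu> * ?S"
    using sphere_int_cmult[of "- of_real \<nu>" "\<lambda>p. f p * cnj (g p)"] by (simp add: mult_ac)
  finally have "(of_real \<mu> - of_real \<nu>) * ?S = 0"
    by (simp add: algebra_simps)
  then show ?thesis using \<open>\<nu> \<noteq> \<mu>\<close> by simp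
qed

lemma half_sgrad_diff_diff:
  assumes "chart_smooth F" "chart_smooth G" "chart_smooth H"
  shows "vscale (1/2) (vsub (vsub (sgrad F) (sgrad G)) (sgrad H)) = sgrad (\<lambda>p. 1/2 * (F p - G p - H p))"
  using assms by (simp only: sgrad_diff sgrad_cmult chart_smooth_rules)

text \<open>The curvature needs \<open>\<nabla>\<close> only between an eigenfield \<open>u = sgrad \<psi>\<close>, \<open>\<Delta>\<psi> = - \<nu>\<psi>\<close>, and other stream
  fields \<open>sgrad f\<close>; there \<open>B(u, sgrad f) = sgrad (- \<nu> z)\<close> and \<open>B(sgrad f, u) = sgrad (- y)\<close>, where
  \<open>\<Delta>z = {\<psi>, f}\<close> and \<open>\<Delta>y = {\<psi>, \<Delta>f}\<close>.\<close>
lemma nabla_eigenfield: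
  assumes \<psi>: "has_laplacian \<psi> (\<lambda>p. - of_real \<nu> * \<psi> p)" and f: "has_laplacian f b"
    and z: "has_laplacian z t" "chart_eq t (poisson \<psi> f)"
    and y: "has_laplacian y s" "chart_eq s (poisson \<psi> b)"
  shows "chart_eq (nabla (sgrad \<psi>) (sgrad f)) (sgrad (\<lambda>p. 1/2 * (t p + of_real \<nu> * z p + y p)))"
    and "chart_eq (nabla (sgrad f) (sgrad \<psi>)) (sgrad (\<lambda>p. 1/2 * (- t p + of_real \<nu> * z p + y p)))"
proof -
  note smooth = has_laplacian_chart_smooth[OF \<psi>] has_laplacian_chart_smooth[OF f]
    has_laplacian_chart_smooth[OF z(1)] has_laplacian_chart_smooth[OF y(1)]
  have B_\<psi>_f: "Bop (sgrad \<psi>) (sgrad f) = sgrad (\<lambda>p. - of_real \<nu> * z p)"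
    using z(2)
    by (intro Bop_sgrad[OF \<psi> _ has_laplacian_cmult[OF z(1)]] has_laplacian_sphere_fun(1)[OF f])
      (simp only: chart_eq_def poisson_cmult_left[OF smooth(1)], simp)
  have B_f_\<psi>: "Bop (sgrad f) (sgrad \<psi>) = sgrad (\<lambda>p. - 1 * y p)"
    using y(2)
    by (intro Bop_sgrad[OF f _ has_laplacian_cmult[OF y(1)]] has_laplacian_sphere_fun(1)[OF \<psi>])
      (simp add: chart_eq_def poisson_commute[of _ \<psi>])
  have nabla:
      "chart_eq (vscale (1/2) (vsub (vsub X (sgrad G)) (sgrad H))) (sgrad (\<lambda>p. 1/2 * (F p - G p - H p)))"
    if "chart_eq X (sgrad F)" "chart_smooth F" "chart_smooth G" "chart_smooth H" for X F G H
    unfolding half_sgrad_diff_diff[OF that(2-4), symmetric]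
    by (intro vscale_chart_cong vsub_chart_cong chart_eq_refl that(1))
  have "chart_eq (lie (sgrad \<psi>) (sgrad f)) (sgrad t)"
    using lie_sgrad[OF smooth(1,3)] sgrad_chart_cong[OF chart_eq_sym[OF z(2)]] by (rule chart_eq_trans)
  then have "chart_eq (nabla (sgrad \<psi>) (sgrad f)) (sgrad (\<lambda>p. 1/2 * (t p - - of_real \<nu> * z p - - 1 * y p)))"
    unfolding nabla_def B_\<psi>_f B_f_\<psi> by (intro nabla chart_smooth_rules smooth)
  then show "chart_eq (nabla (sgrad \<psi>) (sgrad f)) (sgrad (\<lambda>p. 1/2 * (t p + of_real \<nu> * z p + y p)))"
    by simp
  have "chart_eq (poisson f \<psi>) (\<lambda>p. - t p)"
    using z(2) by (simp add: chart_eq_def poisson_commute[of _ \<psi>])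
  with lie_sgrad[OF smooth(3,1)] have "chart_eq (lie (sgrad f) (sgrad \<psi>)) (sgrad (\<lambda>p. - t p))"
    using sgrad_chart_cong chart_eq_trans by blast
  then have "chart_eq (nabla (sgrad f) (sgrad \<psi>)) (sgrad (\<lambda>p. 1/2 * (- t p - - 1 * y p - - of_real \<nu> * z p)))"
    unfolding nabla_def B_\<psi>_f B_f_\<psi> by (intro nabla chart_smooth_rules smooth)
  then show "chart_eq (nabla (sgrad f) (sgrad \<psi>)) (sgrad (\<lambda>p. 1/2 * (- t p + of_real \<nu> * z p + y p)))"
    by (simp add: algebra_simps)
qed

lemma nabla_sgrad_const:
  assumes f: "has_laplacian f b"
  shows "chart_eq (nabla (sgrad f) (sgrad (\<lambda>p. c))) (\<lambda>p. (0, 0))"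
proof -
  have "Bop (sgrad f) (sgrad (\<lambda>p. c)) = sgrad (\<lambda>p. 0)" "Bop (sgrad (\<lambda>p. c)) (sgrad f) = sgrad (\<lambda>p. 0)"
    by (rule Bop_sgrad[OF f _ has_laplacian_const] Bop_sgrad[OF has_laplacian_const _ has_laplacian_const];
        simp add: sphere_fun_const has_laplacian_sphere_fun[OF f] chart_eq_def poisson_const
          poisson_commute[of "\<lambda>p. 0"])+
  moreover have "lie (sgrad f) (\<lambda>p. (0, 0)) = (\<lambda>p. (0, 0))"
    by (simp add: lie_def dir_der_def d_theta_simps d_phi_simps fun_eq_iff)
  ultimately show ?thesis
    by (simp add: nabla_def sgrad_const chart_eq_def vscale_def vsub_def vadd_def)
qed

lemma nabla_eigenfield_self:
  assumes "has_laplacian \<psi> (\<lambda>p. - of_real \<nu> * \<psi> p)"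
  shows "chart_eq (nabla (sgrad \<psi>) (sgrad \<psi>)) (sgrad (\<lambda>p. 0))"
proof -
  have "chart_eq (\<lambda>p. 0) (poisson \<psi> \<psi>)" "chart_eq (\<lambda>p. 0) (poisson \<psi> (\<lambda>p. - of_real \<nu> * \<psi> p))"
    by (simp_all only: chart_eq_def poisson_cmult[OF has_laplacian_chart_smooth(1)[OF assms]]
      poisson_self mult_zero_right)
      simp_all
  from nabla_eigenfield(1)[OF assms assms has_laplacian_const this(1) has_laplacian_const this(2),
      of 0 0]
  show ?thesis by simp
qed

text \<open>The weight in the curvature of the passage from the eigenvalue \<open>L\<close> to \<open>L'\<close> and back
  under the bracket with \<open>\<psi>\<close>.\<close>
definition curv_weight :: "real \<Rightarrow> real \<Rightarrow> real \<Rightarrow> real" where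
  "curv_weight \<nu> L L' = (- 1 + (L' - \<nu>) / L) / 2 - (- 1 + (L - \<nu>) / L') * (1 + (L' - \<nu>) / L) / 4"

locale eigenfield_coupling =
  fixes \<psi> :: "real \<times> real \<Rightarrow> complex" and \<nu> :: real
    and E :: "'i \<Rightarrow> real \<times> real \<Rightarrow> complex" and \<mu> :: "'i \<Rightarrow> real"
    and I :: "'i set" and N :: "'i \<Rightarrow> 'i set" and c :: "'i \<Rightarrow> 'i \<Rightarrow> complex"
  assumes eigenfunction_psi: "has_laplacian \<psi> (\<lambda>p. - of_real \<nu> * \<psi> p)"
    and eigenfunction: "has_laplacian (E n) (\<lambda>p. - of_real (\<mu> n) * E n p)"
    and inj_eigenvalue: "inj \<mu>"
    and finite_neighbours: "finite (N n)"
    and bracket: "n \<in> I \<Longrightarrow> chart_eq (poisson \<psi> (E n)) (\<lambda>p. \<Sum>k\<in>N n. c n k * E k p)"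
    and eigenvalue_nonzero: "n \<in> I \<Longrightarrow> k \<in> N n \<Longrightarrow> \<mu> k \<noteq> 0"
begin

text \<open>Twice the stream function of the derivative of \<open>sgrad (E n)\<close> along \<open>sgrad \<psi>\<close> (\<open>\<sigma> = 1\<close>), or of
  \<open>sgrad \<psi>\<close> along \<open>sgrad (E n)\<close> (\<open>\<sigma> = -1\<close>).\<close>
definition connection :: "real \<Rightarrow> 'i \<Rightarrow> real \<times> real \<Rightarrow> complex" where
  "connection \<sigma> n p = (\<Sum>k\<in>N n. c n k * of_real (\<sigma> + (\<mu> n - \<nu>) / \<mu> k) * E k p)"

lemma sphere_fun_eigenfunction: "sphere_fun (E n)"
  by (rule has_laplacian_sphere_fun(1)[OF eigenfunction])

lemma sphere_fun_connection: "sphere_fun (connection \<sigma> n)"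
  unfolding connection_def[abs_def] by (intro sphere_fun_intros sphere_fun_eigenfunction)

lemmas chart_smooth_eigenfunction = sphere_fun_chart_smooth[OF sphere_fun_eigenfunction]
lemmas chart_smooth_connection = sphere_fun_chart_smooth[OF sphere_fun_connection]

lemma inner_eigenfunctions: "n \<noteq> k \<Longrightarrow> sphere_int (\<lambda>p. E n p * cnj (E k p)) = 0"
  using inj_eigenvalue by (intro eigenfunctions_orthogonal[OF eigenfunction eigenfunction])
    (auto dest: injD)

lemma inner_connection:
  assumes "l \<in> N n"
  shows "sphere_int (\<lambda>p. connection \<sigma> n p * cnj (E l p))
    = c n l * of_real (\<sigma> + (\<mu> n - \<nu>) / \<mu> l) * sphere_int (\<lambda>p. E l p * cnj (E l p))"
proof -
  let ?w = "\<lambda>k. c n k * of_real (\<sigma> + (\<mu> n - \<nu>) / \<mu> k)"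
  have "sphere_int (\<lambda>p. connection \<sigma> n p * cnj (E l p))
      = sphere_int (\<lambda>p. \<Sum>k\<in>N n. ?w k * (E k p * cnj (E l p)))"
    by (simp add: connection_def sum_distrib_right mult.assoc)
  also have "\<dots> = (\<Sum>k\<in>N n. ?w k * sphere_int (\<lambda>p. E k p * cnj (E l p)))"
    unfolding sphere_int_cmult[symmetric]
    by (intro sphere_int_sum chart_smooth_rules chart_smooth_eigenfunction)
  also have "\<dots> = (\<Sum>k\<in>N n. if k = l then ?w l * sphere_int (\<lambda>p. E l p * cnj (E l p)) else 0)"
    by (intro sum.cong) (auto simp: inner_eigenfunctions)
  also have "\<dots> = ?w l * sphere_int (\<lambda>p. E l p * cnj (E l p))"
    using assms finite_neighbours by simp
  finally show ?thesis .
qed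

lemma nabla_sum:
  assumes "A \<subseteq> I"
  shows "chart_eq (nabla (sgrad \<psi>) (sgrad (\<lambda>p. \<Sum>n\<in>A. x n * E n p)))
      (sgrad (\<lambda>p. \<Sum>n\<in>A. x n / 2 * connection 1 n p))"
    and "chart_eq (nabla (sgrad (\<lambda>p. \<Sum>n\<in>A. x n * E n p)) (sgrad \<psi>))
      (sgrad (\<lambda>p. \<Sum>n\<in>A. x n / 2 * connection (- 1) n p))"
proof -
  define \<tau> where "\<tau> n p = (\<Sum>k\<in>N n. c n k * E k p)" for n p
  define \<zeta> where "\<zeta> n p = (\<Sum>k\<in>N n. c n k * of_real (- 1 / \<mu> k) * E k p)" for n p
  have \<zeta>: "has_laplacian (\<zeta> n) (\<tau> n)" if "n \<in> A" for n
  proof -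
    have "has_laplacian (\<zeta> n) (\<lambda>p. \<Sum>k\<in>N n. c n k * of_real (- 1 / \<mu> k) * (- of_real (\<mu> k) * E k p))"
      unfolding \<zeta>_def[abs_def] by (intro has_laplacian_sum has_laplacian_cmult eigenfunction)
    also have "(\<lambda>p. \<Sum>k\<in>N n. c n k * of_real (- 1 / \<mu> k) * (- of_real (\<mu> k) * E k p)) = \<tau> n"
      unfolding \<tau>_def[abs_def] using eigenvalue_nonzero that \<open>A \<subseteq> I\<close> by (intro ext sum.cong) auto
    finally show ?thesis .
  qed
  have \<tau>: "chart_eq (poisson \<psi> (E n)) (\<tau> n)" if "n \<in> A" for n
    unfolding \<tau>_def[abs_def] using bracket that \<open>A \<subseteq> I\<close> by blast
  have poisson_sum_E: "chart_eq (\<lambda>p. \<Sum>n\<in>A. y n * \<tau> n p) (poisson \<psi> (\<lambda>p. \<Sum>n\<in>A. y n * E n p))" for y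
    using \<tau>
    by (auto simp: chart_eq_def poisson_sum poisson_cmult sphere_fun_intros sphere_fun_eigenfunction
        sphere_fun_chart_smooth intro!: sum.cong)
  have f: "has_laplacian (\<lambda>p. \<Sum>n\<in>A. x n * E n p) (\<lambda>p. \<Sum>n\<in>A. x n * (- of_real (\<mu> n)) * E n p)"
    unfolding mult.assoc by (intro has_laplacian_sum has_laplacian_cmult eigenfunction)
  have z: "has_laplacian (\<lambda>p. \<Sum>n\<in>A. y n * \<zeta> n p) (\<lambda>p. \<Sum>n\<in>A. y n * \<tau> n p)" for y
    by (intro has_laplacian_sum has_laplacian_cmult \<zeta>)
  note nabla = nabla_eigenfield[OF eigenfunction_psi f z poisson_sum_E z poisson_sum_E]
  have connection: "connection \<sigma> n p = of_real \<sigma> * \<tau> n p - of_real (\<mu> n - \<nu>) * \<zeta> n p" for \<sigma> n p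
    unfolding connection_def \<tau>_def \<zeta>_def sum_distrib_left sum_subtractf[symmetric]
    by (intro sum.cong) (simp_all add: algebra_simps)
  show "chart_eq (nabla (sgrad \<psi>) (sgrad (\<lambda>p. \<Sum>n\<in>A. x n * E n p)))
      (sgrad (\<lambda>p. \<Sum>n\<in>A. x n / 2 * connection 1 n p))"
    using nabla(1) unfolding connection sum_distrib_left sum_negf[symmetric] sum.distrib[symmetric]
    by (simp add: algebra_simps diff_divide_distrib)
  show "chart_eq (nabla (sgrad (\<lambda>p. \<Sum>n\<in>A. x n * E n p)) (sgrad \<psi>))
      (sgrad (\<lambda>p. \<Sum>n\<in>A. x n / 2 * connection (- 1) n p))"
    using nabla(2) unfolding connection sum_distrib_left sum_negf[symmetric] sum.distrib[symmetric]
    by (simp add: algebra_simps diff_divide_distrib)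
qed

lemma Rcurv_eigenfunction:
  assumes l: "l \<in> I" "N l \<subseteq> I"
  shows "chart_eq (Rcurv (sgrad \<psi>) (sgrad (E l)) (sgrad \<psi>))
    (sgrad (\<lambda>p. \<Sum>k\<in>N l. c l k * (1/2 * connection (- 1) k p
      - of_real ((- 1 + (\<mu> l - \<nu>) / \<mu> k) / 4) * connection 1 k p)))"
proof -
  let ?u = "sgrad \<psi>" and ?v = "sgrad (E l)"
  let ?w = "\<lambda>k. c l k * of_real (- 1 + (\<mu> l - \<nu>) / \<mu> k) / 2"
  let ?F = "\<lambda>p. \<Sum>k\<in>N l. ?w k / 2 * connection 1 k p"
    and ?G = "\<lambda>p. \<Sum>k\<in>N l. c l k / 2 * connection (- 1) k p"
  have "chart_eq (nabla ?v ?u) (sgrad (\<lambda>p. \<Sum>k\<in>N l. ?w k * E k p))"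
    using nabla_sum(2)[of "{l}" "\<lambda>_. 1"] l by (simp add: connection_def sum_divide_distrib)
  then have "chart_eq (nabla ?u (nabla ?v ?u)) (nabla ?u (sgrad (\<lambda>p. \<Sum>k\<in>N l. ?w k * E k p)))"
    by (rule nabla_chart_cong[OF chart_eq_refl])
  also have "chart_eq \<dots> (sgrad ?F)"
    by (rule nabla_sum(1)[OF l(2)])
  finally have nabla_u: "chart_eq (nabla ?u (nabla ?v ?u)) (sgrad ?F)" .
  have nabla_v: "chart_eq (nabla ?v (nabla ?u ?u)) (\<lambda>p. (0, 0))"
    using nabla_chart_cong[OF chart_eq_refl nabla_eigenfield_self[OF eigenfunction_psi]]
      nabla_sgrad_const[OF eigenfunction] by (rule chart_eq_trans)
  have "chart_eq (lie ?u ?v) (sgrad (\<lambda>p. \<Sum>k\<in>N l. c l k * E k p))"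
    using lie_sgrad sgrad_chart_cong[OF bracket[OF l(1)]] eigenfunction eigenfunction_psi
    by (blast intro: chart_eq_trans has_laplacian_chart_smooth)
  then have "chart_eq (nabla (lie ?u ?v) ?u) (nabla (sgrad (\<lambda>p. \<Sum>k\<in>N l. c l k * E k p)) ?u)"
    by (rule nabla_chart_cong[OF _ chart_eq_refl])
  also have "chart_eq \<dots> (sgrad ?G)"
    by (rule nabla_sum(2)[OF l(2)])
  finally have nabla_lie: "chart_eq (nabla (lie ?u ?v) ?u) (sgrad ?G)" .
  have smooth: "chart_smooth ?F" "chart_smooth ?G"
    by (intro sphere_fun_chart_smooth sphere_fun_intros sphere_fun_connection)+
  have "chart_eq (Rcurv ?u ?v ?u) (vadd (vadd (vscale (- 1) (sgrad ?F)) (\<lambda>p. (0, 0))) (sgrad ?G))"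
    unfolding Rcurv_def by (intro vadd_chart_cong vscale_chart_cong nabla_u nabla_v nabla_lie)
  also have "\<dots> = sgrad (\<lambda>p. - 1 * ?F p + ?G p)"
    by (simp only: vadd_zero sgrad_cmult[OF smooth(1)]
      sgrad_add[OF chart_smooth_mult[OF chart_smooth_const smooth(1)] smooth(2)])
  also have "(\<lambda>p. - 1 * ?F p + ?G p) = (\<lambda>p. \<Sum>k\<in>N l.
      c l k * (1/2 * connection (- 1) k p - of_real ((- 1 + (\<mu> l - \<nu>) / \<mu> k) / 4) * connection 1 k p))"
    unfolding sum_distrib_left sum.distrib[symmetric]
    by (intro ext sum.cong) (simp_all add: algebra_simps diff_divide_distrib)
  finally show ?thesis .
qed

lemma inner_curvature_summand:
  assumes "l \<in> N k"
  shows "sphere_int (\<lambda>p. (1/2 * connection (- 1) k p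
      - of_real ((- 1 + (\<mu> l - \<nu>) / \<mu> k) / 4) * connection 1 k p) * cnj (E l p))
    = c k l * of_real (curv_weight \<nu> (\<mu> l) (\<mu> k)) * sphere_int (\<lambda>p. E l p * cnj (E l p))"
proof -
  let ?w = "of_real ((- 1 + (\<mu> l - \<nu>) / \<mu> k) / 4) :: complex"
  have "sphere_int (\<lambda>p. (1/2 * connection (- 1) k p - ?w * connection 1 k p) * cnj (E l p))
      = 1/2 * sphere_int (\<lambda>p. connection (- 1) k p * cnj (E l p))
        - ?w * sphere_int (\<lambda>p. connection 1 k p * cnj (E l p))"
    unfolding left_diff_distrib mult.assoc sphere_int_cmult[symmetric]
    by (intro sphere_int_diff chart_smooth_rules chart_smooth_connection chart_smooth_eigenfunction)
  also have "\<dots> = c k l * of_real (curv_weight \<nu> (\<mu> l) (\<mu> k)) * sphere_int (\<lambda>p. E l p * cnj (E l p))"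
    unfolding inner_connection[OF assms] curv_weight_def
    by (simp add: algebra_simps diff_divide_distrib add_divide_distrib)
  finally show ?thesis .
qed

lemma herm_Rcurv_eigenfunction:
  assumes l: "l \<in> I" "N l \<subseteq> I" and mutual: "\<And>k. k \<in> N l \<Longrightarrow> l \<in> N k"
  shows "herm (Rcurv (sgrad \<psi>) (sgrad (E l)) (sgrad \<psi>)) (sgrad (E l))
    = (\<Sum>k\<in>N l. c l k * c k l * of_real (curv_weight \<nu> (\<mu> l) (\<mu> k))) * herm (sgrad (E l)) (sgrad (E l))"
proof -
  define f where "f k p = 1/2 * connection (- 1) k p
    - of_real ((- 1 + (\<mu> l - \<nu>) / \<mu> k) / 4) * connection 1 k p" for k p
  have f: "sphere_fun (f k)" for k
    unfolding f_def[abs_def] by (intro sphere_fun_intros sphere_fun_connection)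
  note herm = herm_sgrad_eigenfunction[OF _ eigenfunction]
  have "herm (Rcurv (sgrad \<psi>) (sgrad (E l)) (sgrad \<psi>)) (sgrad (E l))
      = herm (sgrad (\<lambda>p. \<Sum>k\<in>N l. c l k * f k p)) (sgrad (E l))"
    unfolding f_def by (rule herm_chart_cong[OF Rcurv_eigenfunction[OF l] chart_eq_refl])
  also have "\<dots> = of_real (\<mu> l) * sphere_int (\<lambda>p. \<Sum>k\<in>N l. c l k * (f k p * cnj (E l p)))"
    by (subst herm) (auto intro!: sphere_fun_intros f simp: sum_distrib_right mult.assoc)
  also have "sphere_int (\<lambda>p. \<Sum>k\<in>N l. c l k * (f k p * cnj (E l p)))
      = (\<Sum>k\<in>N l. c l k * sphere_int (\<lambda>p. f k p * cnj (E l p)))"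
    unfolding sphere_int_cmult[symmetric]
    by (intro sphere_int_sum chart_smooth_rules sphere_fun_chart_smooth[OF f] chart_smooth_eigenfunction)
  also have "\<dots> = (\<Sum>k\<in>N l. c l k * c k l * of_real (curv_weight \<nu> (\<mu> l) (\<mu> k)))
      * sphere_int (\<lambda>p. E l p * cnj (E l p))"
    unfolding sum_distrib_right f_def
    by (intro sum.cong) (simp_all only: inner_curvature_summand[OF mutual] mult.assoc)
  finally show ?thesis
    by (simp add: herm[OF sphere_fun_eigenfunction])
qed

lemma sec_curv_eigenfunction:
  assumes l: "l \<in> I" "N l \<subseteq> I" and mutual: "\<And>k. k \<in> N l \<Longrightarrow> l \<in> N k"
    and "\<mu> l \<noteq> \<nu>" "\<mu> l \<noteq> 0" and norm: "sphere_int (\<lambda>p. E l p * cnj (E l p)) \<noteq> 0"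
  shows "sec_curv (sgrad \<psi>) (sgrad (E l))
    = (\<Sum>k\<in>N l. c l k * c k l * of_real (curv_weight \<nu> (\<mu> l) (\<mu> k))) / herm (sgrad \<psi>) (sgrad \<psi>)"
proof -
  note herm = herm_sgrad_eigenfunction[OF _ eigenfunction]
  have "herm (sgrad \<psi>) (sgrad (E l)) = 0"
    using herm[OF has_laplacian_sphere_fun(1)[OF eigenfunction_psi]]
      eigenfunctions_orthogonal[OF eigenfunction_psi eigenfunction] \<open>\<mu> l \<noteq> \<nu>\<close> by simp
  moreover have "herm (sgrad (E l)) (sgrad (E l)) \<noteq> 0"
    using herm[OF sphere_fun_eigenfunction] norm \<open>\<mu> l \<noteq> 0\<close> by simp
  ultimately show ?thesis
    by (simp add: sec_curv_def herm_Rcurv_eigenfunction[OF l mutual])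
qed

end

section \<open>Derivatives of Legendre polynomials\<close>

definition rodrigues :: "nat \<Rightarrow> nat \<Rightarrow> real poly" where
  "rodrigues n j = (pderiv ^^ j) ([:-1, 0, 1:] ^ n)"

definition legendre_deriv :: "nat \<Rightarrow> nat \<Rightarrow> real poly" where
  "legendre_deriv k n = smult (1 / (2 ^ n * fact n)) (rodrigues n (n + k))"

lemma pderiv_rodrigues: "pderiv (rodrigues n j) = rodrigues n (Suc j)"
  by (simp add: rodrigues_def)

lemma higher_deriv_rodrigues: "(deriv ^^ j) (\<lambda>x. (x\<^sup>2 - 1) ^ n) = poly (rodrigues n j)"
proof (induction j)
  case 0
  show ?case by (simp add: rodrigues_def fun_eq_iff power2_eq_square algebra_simps)
next
  case (Suc j)
  show ?case
    unfolding funpow.simps o_apply Suc pderiv_rodrigues[symmetric]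
    by (intro ext DERIV_imp_deriv poly_DERIV)
qed

lemma pderiv_rodrigues_base:
  "pderiv ([:-1, 0, 1:] ^ Suc n) = smult (2 * real (Suc n)) ([:0, 1:] * [:-1, 0, 1:] ^ n :: real poly)"
  unfolding pderiv_power_Suc by (simp add: pderiv_pCons mult.commute)

lemma higher_pderiv_X_mult:
  fixes p :: "'a::{comm_semiring_1, semiring_no_zero_divisors} poly"
  shows "(pderiv ^^ Suc i) ([:0, 1:] * p) = [:0, 1:] * (pderiv ^^ Suc i) p
      + smult (of_nat (Suc i)) ((pderiv ^^ i) p)"
proof (induction i)
  case 0
  show ?case by (simp add: pderiv_pCons add.commute)
next
  case (Suc i)
  have "(pderiv ^^ Suc (Suc i)) ([:0, 1:] * p) = pderiv ((pderiv ^^ Suc i) ([:0, 1:] * p))" by simp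
  also have "\<dots> = [:0, 1:] * (pderiv ^^ Suc (Suc i)) p + smult (of_nat (Suc (Suc i))) ((pderiv ^^ Suc i) p)"
    unfolding Suc
    by (simp add: pderiv_mult pderiv_pCons pderiv_add pderiv_smult smult_add_left algebra_simps)
  finally show ?case .
qed

lemma poly_rodrigues_Suc_Suc:
  "poly (rodrigues (Suc n) (Suc (Suc i))) x =
     2 * real (Suc n) * (x * poly (rodrigues n (Suc i)) x + real (Suc i) * poly (rodrigues n i) x)"
proof -
  have "rodrigues (Suc n) (Suc (Suc i)) = (pderiv ^^ Suc i) (pderiv ([:-1, 0, 1:] ^ Suc n))"
    unfolding rodrigues_def by (simp only: funpow_Suc_right o_apply)
  also have "\<dots> = smult (2 * real (Suc n)) ([:0, 1:] * rodrigues n (Suc i)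
      + smult (real (Suc i)) (rodrigues n i))"
    unfolding pderiv_rodrigues_base higher_pderiv_smult higher_pderiv_X_mult rodrigues_def ..
  finally show ?thesis by simp
qed

lemma poly_rodrigues_three_term:
  "poly (rodrigues (Suc (Suc n)) (Suc (Suc i))) x = 2 * (real n + 2) *
     ((2 * real n + 3) * poly (rodrigues (Suc n) i) x + 2 * (real n + 1) * poly (rodrigues n i) x)"
proof -
  have "pderiv (pderiv ([:-1, 0, 1:] ^ Suc (Suc n))) = smult (2 * (real n + 2))
     (smult (2 * real n + 3) ([:-1, 0, 1:] ^ Suc n) + smult (2 * (real n + 1)) ([:-1, 0, 1:] ^ n))"
    unfolding pderiv_rodrigues_base[of "Suc n"] pderiv_smult pderiv_mult pderiv_rodrigues_base[of n]
    by (rule poly_eq_poly_eq_iff[THEN iffD1]) (simp add: fun_eq_iff pderiv_pCons algebra_simps)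
  moreover have "rodrigues (Suc (Suc n)) (Suc (Suc i))
      = (pderiv ^^ i) (pderiv (pderiv ([:-1, 0, 1:] ^ Suc (Suc n))))"
    unfolding rodrigues_def by (simp only: funpow_Suc_right o_apply)
  ultimately have "rodrigues (Suc (Suc n)) (Suc (Suc i)) = smult (2 * (real n + 2))
     (smult (2 * real n + 3) (rodrigues (Suc n) i) + smult (2 * (real n + 1)) (rodrigues n i))"
    by (simp add: rodrigues_def higher_pderiv_smult higher_pderiv_add del: power_Suc)
  then show ?thesis by simp
qed

lemma rodrigues_ode:
  "[:-1, 0, 1:] * rodrigues n (Suc (Suc j))
    + smult (2 * (real j + 1 - real n)) ([:0, 1:] * rodrigues n (Suc j))
    + smult ((real j + 1) * (real j - 2 * real n)) (rodrigues n j) = 0" (is "?ode j = 0")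
proof (induction j)
  case 0
  have "[:-1, 0, 1:] * rodrigues n 1 - smult (2 * real n) ([:0, 1:] * rodrigues n 0) = 0"
  proof (cases n)
    case 0
    then show ?thesis by (simp add: rodrigues_def pderiv_1)
  next
    case (Suc k)
    have "rodrigues n 1 = pderiv ([:-1, 0, 1:] ^ Suc k)" by (simp add: rodrigues_def Suc)
    then show ?thesis
      unfolding pderiv_rodrigues_base by (simp add: Suc rodrigues_def algebra_simps)
  qed
  then have "pderiv ([:-1, 0, 1:] * rodrigues n 1 - smult (2 * real n) ([:0, 1:] * rodrigues n 0)) = 0"
    by simp
  moreover have "pderiv ([:-1, 0, 1:] * rodrigues n 1 - smult (2 * real n) ([:0, 1:] * rodrigues n 0)) = ?ode 0"
    by (intro poly_eq_poly_eq_iff[THEN iffD1])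
      (simp add: fun_eq_iff pderiv_mult pderiv_smult pderiv_pCons pderiv_diff pderiv_add pderiv_rodrigues
        algebra_simps)
  ultimately show ?case by simp
next
  case (Suc j)
  have "pderiv (?ode j) = ?ode (Suc j)"
    by (intro poly_eq_poly_eq_iff[THEN iffD1])
      (simp add: fun_eq_iff pderiv_mult pderiv_add pderiv_diff pderiv_smult pderiv_pCons pderiv_rodrigues
        algebra_simps)
  then show ?case by (simp only: Suc.IH pderiv_0)
qed

lemma base_power_dvd_rodrigues: "j \<le> n \<Longrightarrow> [:-1, 0, 1:] ^ (n - j) dvd rodrigues n j"
proof (induction j)
  case 0
  then show ?case by (simp add: rodrigues_def)
next
  case (Suc j)
  define a where "a = n - Suc j"
  have "[:-1, 0, 1:] ^ Suc a dvd rodrigues n j"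
    using Suc by (simp add: a_def Suc_diff_Suc del: power_Suc)
  then obtain g where "rodrigues n j = [:-1, 0, 1:] ^ Suc a * g" by (auto elim: dvdE)
  then have "rodrigues n (Suc j)
      = [:-1, 0, 1:] ^ a * ([:-1, 0, 1:] * pderiv g + smult (2 * real (Suc a)) ([:0, 1:] * g))"
    unfolding pderiv_rodrigues[symmetric]
    by (simp only: pderiv_mult pderiv_rodrigues_base) (simp add: algebra_simps)
  then show ?case unfolding a_def[symmetric] by (metis dvd_triv_left)
qed

lemma poly_rodrigues_at_1:
  assumes "j < n"
  shows "poly (rodrigues n j) 1 = 0"
proof -
  obtain g where "rodrigues n j = [:-1, 0, 1:] ^ (n - j) * g"
    using base_power_dvd_rodrigues[of j n] assms by (auto elim: dvdE)
  then show ?thesis using assms by simp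
qed

text \<open>Both sides vanish at \<open>1\<close>, and their derivatives agree by the differential equation.\<close>
lemma rodrigues_reflect:
  assumes "k \<le> n"
  shows "\<exists>c\<noteq>0. rodrigues n (n - k) = smult c ([:-1, 0, 1:] ^ k * rodrigues n (n + k))"
  using assms
proof (induction k)
  case 0
  show ?case by (rule exI[of _ 1]) simp
next
  case (Suc k)
  then obtain c where c: "c \<noteq> 0" "rodrigues n (n - k) = smult c ([:-1, 0, 1:] ^ k * rodrigues n (n + k))"
    by auto
  define e where "e = (real n - real k) * (real n + real k + 1)"
  have e: "e \<noteq> 0" using Suc.prems by (simp add: e_def)
  have ode: "[:-1, 0, 1:] * rodrigues n (Suc (Suc (n + k)))
      + smult (2 * real (Suc k)) ([:0, 1:] * rodrigues n (Suc (n + k)))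
      = smult e (rodrigues n (n + k))"
  proof -
    have "2 * (real (n + k) + 1 - real n) = 2 * real (Suc k)"
      "(real (n + k) + 1) * (real (n + k) - 2 * real n) = - e" by (auto simp: e_def algebra_simps)
    with rodrigues_ode[of n "n + k"] show ?thesis
      by (simp only: smult_minus_left diff_conv_add_uminus[symmetric] right_minus_eq)
  qed
  define f where "f = smult (c / e) ([:-1, 0, 1:] ^ Suc k * rodrigues n (n + Suc k))"
  have "pderiv f = smult (c / e) ([:-1, 0, 1:] ^ k * smult e (rodrigues n (n + k)))"
    unfolding f_def pderiv_smult pderiv_mult pderiv_rodrigues_base pderiv_rodrigues ode[symmetric]
    by (simp add: algebra_simps)
  also have "\<dots> = pderiv (rodrigues n (n - Suc k))"
    using c(2) e Suc.prems by (simp add: pderiv_rodrigues Suc_diff_Suc)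
  finally have "pderiv (rodrigues n (n - Suc k) - f) = 0" by (simp add: pderiv_diff)
  then obtain d where d: "rodrigues n (n - Suc k) - f = [:d:]"
    by (metis degree_eq_zeroE pderiv_eq_0_iff)
  have "poly (rodrigues n (n - Suc k) - f) 1 = 0"
    using Suc.prems by (simp add: f_def poly_rodrigues_at_1)
  then have "rodrigues n (n - Suc k) = f" using d by simp
  then show ?case using c e unfolding f_def by (intro exI[of _ "c / e"]) simp
qed

lemma rodrigues_nonzero: "j \<le> 2 * n \<Longrightarrow> rodrigues n j \<noteq> 0"
proof (induction j)
  case 0
  then show ?case by (simp add: rodrigues_def)
next
  case (Suc j)
  have "degree (rodrigues n j) = 2 * n - j"
    unfolding rodrigues_def degree_higher_pderiv by (simp add: degree_power_eq)
  then show ?case using Suc by (simp add: pderiv_eq_0_iff flip: pderiv_rodrigues)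
qed

lemma legendre_deriv_recurrence:
  assumes "n \<ge> 1"
  shows "(2 * real n + 1) * (x * poly (legendre_deriv k n) x) =
     (real n + 1 - real k) * poly (legendre_deriv k (n + 1)) x
     + (real n + real k) * poly (legendre_deriv k (n - 1)) x"
proof -
  obtain i where n: "n = Suc i" using assms not0_implies_Suc by force
  define N :: real where "N = 2 ^ i * fact i"
  define Q where "Q = poly (rodrigues (Suc i) (i + k)) x"
  define P0 P1 P2 where "P0 = poly (rodrigues i (i + k)) x"
    and "P1 = poly (rodrigues (Suc i) (Suc (i + k))) x"
    and "P2 = poly (rodrigues (Suc (Suc i)) (Suc (Suc (i + k)))) x"
  have "P2 = 2 * (real i + 2) * ((2 * real i + 3) * Q + 2 * (real i + 1) * P0)"
    unfolding P2_def Q_def P0_def by (rule poly_rodrigues_three_term)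
  moreover have P2: "P2 = 2 * (real i + 2) * (x * P1 + (real i + real k + 1) * Q)"
    unfolding P2_def Q_def P1_def poly_rodrigues_Suc_Suc by (simp add: algebra_simps)
  ultimately have "x * P1 + (real i + real k + 1) * Q = (2 * real i + 3) * Q + 2 * (real i + 1) * P0"
    by (simp add: add_eq_0_iff)
  with P2 have numerators: "(2 * real i + 3) * (x * P1) * (2 * (real i + 2))
      = (real i + 2 - real k) * P2 + (real i + 1 + real k) * P0 * (4 * (real i + 1) * (real i + 2))"
    by algebra
  have "N \<noteq> 0" by (simp add: N_def)
  have "2 ^ n * fact n = 2 * (real i + 1) * N"
    "2 ^ (n + 1) * fact (n + 1) = 4 * (real i + 1) * (real i + 2) * N"
    "2 ^ (n - 1) * fact (n - 1) = N"
    by (simp_all add: N_def n algebra_simps)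
  then have legendre_deriv: "poly (legendre_deriv k n) x = P1 / (2 * (real i + 1) * N)"
    "poly (legendre_deriv k (n + 1)) x = P2 / (4 * (real i + 1) * (real i + 2) * N)"
    "poly (legendre_deriv k (n - 1)) x = P0 / N"
    unfolding legendre_deriv_def poly_smult by (simp_all add: n P0_def P1_def P2_def)
  have "(2 * real n + 1) * (x * poly (legendre_deriv k n) x)
      = (2 * real i + 3) * (x * P1) * (2 * (real i + 2)) / (4 * (real i + 1) * (real i + 2) * N)"
    unfolding legendre_deriv using \<open>N \<noteq> 0\<close> by (simp add: n divide_simps) (simp add: algebra_simps)
  also have "\<dots> = (real i + 2 - real k) * (P2 / (4 * (real i + 1) * (real i + 2) * N))
      + (real i + 1 + real k) * (P0 / N)"
    unfolding numerators add_divide_distrib using \<open>N \<noteq> 0\<close> by (simp add: divide_simps)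
  finally show ?thesis unfolding legendre_deriv by (simp add: n add_ac)
qed

lemma legendre_deriv_ode:
  "(1 - x\<^sup>2) * poly (pderiv (pderiv (legendre_deriv k n))) x
      - 2 * (real k + 1) * x * poly (pderiv (legendre_deriv k n)) x
     + (real n * (real n + 1) - real k * (real k + 1)) * poly (legendre_deriv k n) x = 0"
proof -
  define c where "c = 1 / (2 ^ n * fact n :: real)"
  have "c * ((x\<^sup>2 - 1) * poly (rodrigues n (Suc (Suc (n + k)))) x
      + 2 * (real (n + k) + 1 - real n) * x * poly (rodrigues n (Suc (n + k))) x
      + (real (n + k) + 1) * (real (n + k) - 2 * real n) * poly (rodrigues n (n + k)) x) = 0"
    using arg_cong[OF rodrigues_ode[of n "n + k"], of "\<lambda>p. poly p x"]
    by (simp add: algebra_simps power2_eq_square)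
  then show ?thesis
    unfolding legendre_deriv_def c_def[symmetric] pderiv_smult pderiv_rodrigues poly_smult of_nat_add
    by algebra
qed

lemma legendre_deriv_nonzero: "k \<le> n \<Longrightarrow> legendre_deriv k n \<noteq> 0"
  by (simp add: legendre_deriv_def rodrigues_nonzero)

lemma legendre_deriv_0_3: "legendre_deriv 0 3 = [:0, - 3/2, 0, 5/2:]"
  by (simp add: legendre_deriv_def rodrigues_def numeral_3_eq_3 pderiv_pCons fact_numeral algebra_simps)

section \<open>Spherical harmonics\<close>

definition harmonic :: "int \<Rightarrow> real poly \<Rightarrow> real \<times> real \<Rightarrow> complex" where
  "harmonic m q p
      = exp (\<i> * of_int m * of_real (snd p)) * (sn p ^ nat \<bar>m\<bar> * of_real (poly q (cos (fst p))))"

lemma sphere_fun_poly_cs: "sphere_fun (\<lambda>p. of_real (poly q (cos (fst p))))"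
  by (induction q) (auto intro!: sphere_fun_intros)

lemma sphere_fun_harmonic: "sphere_fun (harmonic m q)"
proof -
  have nonneg: "sphere_fun (harmonic (int k) q)" for k
  proof -
    have "sphere_fun (\<lambda>p. (sn p * of_real (cos (snd p)) + \<i> * (sn p * of_real (sin (snd p)))) ^ k
        * of_real (poly q (cos (fst p))))"
      by (intro sphere_fun_intros sphere_fun_poly_cs)
    also have "(\<lambda>p. (sn p * of_real (cos (snd p)) + \<i> * (sn p * of_real (sin (snd p)))) ^ k
        * of_real (poly q (cos (fst p)))) = harmonic (int k) q"
    proof
      fix p :: "real \<times> real"
      have "sn p * of_real (cos (snd p)) + \<i> * (sn p * of_real (sin (snd p)))
          = exp (\<i> * of_real (snd p)) * sn p"
        by (simp add: exp_Euler cos_of_real sin_of_real algebra_simps)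
      moreover have "exp (\<i> * of_real (snd p)) ^ k = exp (\<i> * of_int (int k) * of_real (snd p))"
        by (simp add: mult_ac flip: exp_of_nat_mult)
      ultimately show "(sn p * of_real (cos (snd p)) + \<i> * (sn p * of_real (sin (snd p)))) ^ k
          * of_real (poly q (cos (fst p))) = harmonic (int k) q p"
        by (simp add: harmonic_def power_mult_distrib)
    qed
    finally show ?thesis .
  qed
  show ?thesis
  proof (cases "m \<ge> 0")
    case True
    then show ?thesis using nonneg[of "nat m"] by simp
  next
    case False
    have "harmonic m q = (\<lambda>p. cnj (harmonic (- m) q p))"
      by (simp add: harmonic_def fun_eq_iff exp_cnj)
    then show ?thesis
      using False sphere_fun_cnj[OF nonneg[of "nat (- m)"]] by simp
  qed
qed

lemma chart_smooth_harmonic: "chart_smooth (harmonic m q)"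
  by (rule sphere_fun_chart_smooth[OF sphere_fun_harmonic])

lemma harmonic_smult: "harmonic m (smult c q) = (\<lambda>p. of_real c * harmonic m q p)"
  by (simp add: harmonic_def fun_eq_iff)

lemma d_phi_harmonic: "d_phi (harmonic m q) = (\<lambda>p. \<i> * of_int m * harmonic m q p)"
proof (rule d_phi_eqI)
  fix a b
  have "((\<lambda>z. exp (\<i> * of_int m * z))
      has_field_derivative \<i> * of_int m * exp (\<i> * of_int m * of_real b)) (at (of_real b))"
    by (auto intro!: derivative_eq_intros)
  from has_vector_derivative_mult_left[OF has_vector_derivative_real_field[OF this]]
  show "((\<lambda>t. harmonic m q (a, t)) has_vector_derivative \<i> * of_int m * harmonic m q (a, b)) (at b)"
    by (simp add: harmonic_def mult.assoc)
qed

lemma sn_mult_d_theta_harmonic: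
  "sn p * d_theta (harmonic m q) p = of_nat (nat \<bar>m\<bar>) * cs p * harmonic m q p
      - (sn p)\<^sup>2 * harmonic m (pderiv q) p"
proof -
  obtain a b where p: "p = (a, b)" by fastforce
  define k where "k = nat \<bar>m\<bar>"
  define g where "g t = sin t ^ k * poly q (cos t)" for t
  define g' where "g' = real k * sin a ^ (k - 1) * cos a * poly q (cos a)
    - sin a ^ k * (poly (pderiv q) (cos a) * sin a)"
  have "(g has_real_derivative g') (at a)"
    unfolding g_def[abs_def] g'_def
    by (auto intro!: derivative_eq_intros DERIV_chain2[OF poly_DERIV] simp: algebra_simps)
  then have "((\<lambda>t. exp (\<i> * of_int m * of_real b) * complex_of_real (g t)) has_vector_derivative
      exp (\<i> * of_int m * of_real b) * complex_of_real g') (at a)"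
    by (intro has_vector_derivative_mult_right has_vector_derivative_of_real)
  from vector_derivative_at[OF this]
  have "sn p * d_theta (harmonic m q) p = exp (\<i> * of_int m * of_real b) * complex_of_real (sin a * g')"
    by (simp add: p d_theta_def harmonic_def g_def k_def)
  also have "sin a * g' = real k * cos a * (sin a ^ k * poly q (cos a))
      - (sin a)\<^sup>2 * (sin a ^ k * poly (pderiv q) (cos a))"
    unfolding g'_def by (cases k) (simp_all add: algebra_simps power2_eq_square)
  finally show ?thesis
    by (simp add: p harmonic_def[abs_def] algebra_simps flip: k_def)
qed

lemma sn_mult_d_theta_d_theta_harmonic:
  "sn p * d_theta (d_theta (harmonic m q)) p + cs p * d_theta (harmonic m q) p
    = of_nat (nat \<bar>m\<bar>) * (cs p * d_theta (harmonic m q) p - sn p * harmonic m q p)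
      - (sn p)\<^sup>2 * d_theta (harmonic m (pderiv q)) p - 2 * sn p * cs p * harmonic m (pderiv q) p"
proof -
  have "d_theta (\<lambda>p. sn p * d_theta (harmonic m q) p) p
      = d_theta (\<lambda>p. of_nat (nat \<bar>m\<bar>) * cs p * harmonic m q p - sn p * sn p * harmonic m (pderiv q) p) p"
    by (simp add: sn_mult_d_theta_harmonic power2_eq_square)
  then show ?thesis
    by (simp add: d_theta_simps chart_smooth_rules chart_smooth_harmonic power2_eq_square algebra_simps)
qed

lemma harmonic_ode:
  assumes ode: "\<And>x. (1 - x\<^sup>2) * poly (pderiv (pderiv q)) x - 2 * (k + 1) * x * poly (pderiv q) x
     + (L - k * (k + 1)) * poly q x = 0"
  shows "(sn p)\<^sup>2 * harmonic m (pderiv (pderiv q)) p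
    = 2 * (of_real k + 1) * cs p * harmonic m (pderiv q) p
      - (of_real L - of_real k * (of_real k + 1)) * harmonic m q p"
proof -
  define e where "e = exp (\<i> * of_int m * of_real (snd p)) * sn p ^ nat \<bar>m\<bar>"
  let ?x = "cos (fst p)"
  have harmonic_e: "harmonic m r p = e * of_real (poly r ?x)" for r
    by (simp add: harmonic_def e_def)
  have "e * of_real ((1 - ?x\<^sup>2) * poly (pderiv (pderiv q)) ?x - 2 * (k + 1) * ?x * poly (pderiv q) ?x
     + (L - k * (k + 1)) * poly q ?x) = 0"
    unfolding ode by simp
  then show ?thesis
    using cs_sq[of p]
    unfolding harmonic_e of_real_add of_real_diff of_real_mult of_real_power of_real_1 of_real_numeral
    by algebra
qed

lemma has_laplacian_harmonic:
  assumes ode: "\<And>x. (1 - x\<^sup>2) * poly (pderiv (pderiv q)) x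
      - 2 * (real (nat \<bar>m\<bar>) + 1) * x * poly (pderiv q) x
     + (L - real (nat \<bar>m\<bar>) * (real (nat \<bar>m\<bar>) + 1)) * poly q x = 0"
  shows "has_laplacian (harmonic m q) (\<lambda>p. - of_real L * harmonic m q p)"
proof (rule has_laplacianI)
  fix p
  define k :: complex where "k = of_nat (nat \<bar>m\<bar>)"
  let ?h = "harmonic m q" and ?h' = "harmonic m (pderiv q)" and ?h'' = "harmonic m (pderiv (pderiv q))"
  have sn_d_theta: "sn p * d_theta (harmonic m r) p
      = k * cs p * harmonic m r p - (sn p)\<^sup>2 * harmonic m (pderiv r) p" for r
    unfolding k_def by (rule sn_mult_d_theta_harmonic)
  have "(of_int m)\<^sup>2 = k\<^sup>2"
  proof -
    have "k = of_int \<bar>m\<bar>" by (simp add: k_def)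
    then show ?thesis by (simp add: abs_if)
  qed
  then have d_phi_d_phi: "d_phi (d_phi ?h) p = - k\<^sup>2 * ?h p"
    by (simp add: d_phi_harmonic d_phi_simps chart_smooth_rules chart_smooth_harmonic
      power2_eq_square mult_ac)
  have "(sn p)\<^sup>2 * d_theta (d_theta ?h) p + sn p * cs p * d_theta ?h p
      = sn p * (sn p * d_theta (d_theta ?h) p + cs p * d_theta ?h p)"
    by (simp add: power2_eq_square algebra_simps)
  also have "\<dots> = k * (cs p * (sn p * d_theta ?h p) - (sn p)\<^sup>2 * ?h p) - (sn p)\<^sup>2 * (sn p * d_theta ?h' p)
      - 2 * (sn p)\<^sup>2 * cs p * ?h' p"
    unfolding sn_mult_d_theta_d_theta_harmonic k_def[symmetric]
    by (simp add: power2_eq_square algebra_simps)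
  also have "\<dots> = k\<^sup>2 * (cs p)\<^sup>2 * ?h p - k * (sn p)\<^sup>2 * ?h p
      - (sn p)\<^sup>2 * (2 * (k + 1) * cs p * ?h' p - (sn p)\<^sup>2 * ?h'' p)"
    unfolding sn_d_theta by (simp add: power2_eq_square algebra_simps)
  also have "(sn p)\<^sup>2 * ?h'' p = 2 * (k + 1) * cs p * ?h' p - (of_real L - k * (k + 1)) * ?h p"
    using harmonic_ode[OF ode] unfolding k_def of_real_of_nat_eq .
  finally show "(sn p)\<^sup>2 * d_theta (d_theta ?h) p + sn p * cs p * d_theta ?h p + d_phi (d_phi ?h) p
      = (sn p)\<^sup>2 * (- of_real L * ?h p)"
    unfolding d_phi_d_phi using cs_sq[of p] by algebra
qed (intro sphere_fun_intros sphere_fun_harmonic)+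

definition eigval :: "nat \<Rightarrow> real" where
  "eigval n = real n * (real n + 1)"

lemma inj_eigval: "inj eigval"
proof (rule injI)
  fix n l assume "eigval n = eigval l"
  then have "(real n - real l) * (real n + real l + 1) = 0" by (simp add: eigval_def algebra_simps)
  moreover have "real n + real l + 1 \<noteq> 0" by (simp add: add_nonneg_eq_0_iff)
  ultimately show "n = l" by simp
qed

lemma eigval_nonzero: "n \<ge> 1 \<Longrightarrow> eigval n \<noteq> 0"
  by (auto simp: eigval_def)

definition sph_harm :: "int \<Rightarrow> nat \<Rightarrow> real \<times> real \<Rightarrow> complex" where
  "sph_harm m n = harmonic m (legendre_deriv (nat \<bar>m\<bar>) n)"

lemma has_laplacian_sph_harm: "has_laplacian (sph_harm m n) (\<lambda>p. - of_real (eigval n) * sph_harm m n p)"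
  unfolding sph_harm_def eigval_def by (rule has_laplacian_harmonic) (rule legendre_deriv_ode)

lemma sphere_fun_sph_harm: "sphere_fun (sph_harm m n)"
  unfolding sph_harm_def by (rule sphere_fun_harmonic)

lemmas chart_smooth_sph_harm = sphere_fun_chart_smooth[OF sphere_fun_sph_harm]

lemma sph_harm_norm_nonzero:
  assumes "nat \<bar>m\<bar> \<le> n"
  shows "sphere_int (\<lambda>p. sph_harm m n p * cnj (sph_harm m n p)) \<noteq> 0"
proof
  let ?q = "legendre_deriv (nat \<bar>m\<bar>) n" and ?r = "\<lambda>p. (cmod (sph_harm m n p))\<^sup>2"
  have r_eq: "(\<lambda>p. sph_harm m n p * cnj (sph_harm m n p)) = (\<lambda>p. complex_of_real (?r p))"
    by (simp add: complex_norm_square del: of_real_power)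
  have smooth: "chart_smooth (\<lambda>p. complex_of_real (?r p))"
    unfolding r_eq[symmetric] by (intro chart_smooth_rules chart_smooth_sph_harm)
  assume "sphere_int (\<lambda>p. sph_harm m n p * cnj (sph_harm m n p)) = 0"
  then have "sphere_int (\<lambda>p. complex_of_real (?r p)) = 0"
    unfolding r_eq .
  from sphere_int_nonneg_eq_0[OF smooth _ this] have zero: "sph_harm m n p = 0" if "p \<in> chart" for p
    using that by simp
  have "poly ?q (cos t) = 0" if "t \<in> {0<..<pi}" for t
  proof -
    have "(t, pi) \<in> chart" using that by (simp add: chart_def)
    from zero[OF this] sn_nonzero[OF this] show ?thesis
      by (simp add: sph_harm_def harmonic_def)
  qed
  then have "cos ` {0<..<pi} \<subseteq> {x. poly ?q x = 0}" by auto
  then have "finite (cos ` {0<..<pi})"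
    using poly_roots_finite[OF legendre_deriv_nonzero[OF assms]] finite_subset by blast
  moreover have "inj_on cos {0<..<pi}"
    by (rule inj_onI) (rule cos_inj_pi, auto)
  ultimately have "finite {0<..<pi}" using finite_imageD by blast
  then show False using infinite_Ioo[OF pi_gt_zero] by simp
qed

definition legendre_up :: "nat \<Rightarrow> nat \<Rightarrow> real" where
  "legendre_up k n = (real n + 1 - real k) / (2 * real n + 1)"

definition legendre_down :: "nat \<Rightarrow> nat \<Rightarrow> real" where
  "legendre_down k n = (real n + real k) / (2 * real n + 1)"

lemma cs_mult_sph_harm:
  assumes "n \<ge> 1"
  shows "cs p * sph_harm m n p = of_real (legendre_up (nat \<bar>m\<bar>) n) * sph_harm m (n + 1) p
    + of_real (legendre_down (nat \<bar>m\<bar>) n) * sph_harm m (n - 1) p"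
proof -
  let ?k = "nat \<bar>m\<bar>" and ?x = "cos (fst p)"
  have nonzero: "2 * real n + 1 \<noteq> 0" using of_nat_0_le_iff[of n] by linarith
  then have "?x * poly (legendre_deriv ?k n) ?x
      = (2 * real n + 1) * (?x * poly (legendre_deriv ?k n) ?x) / (2 * real n + 1)"
    by simp
  also have "\<dots> = legendre_up ?k n * poly (legendre_deriv ?k (n + 1)) ?x
      + legendre_down ?k n * poly (legendre_deriv ?k (n - 1)) ?x"
    unfolding legendre_deriv_recurrence[OF assms] legendre_up_def legendre_down_def
    by (subst add_divide_distrib) simp
  finally have "complex_of_real (?x * poly (legendre_deriv ?k n) ?x) = complex_of_real \<dots>"
    by (rule arg_cong)
  then show ?thesis
    unfolding sph_harm_def harmonic_def by (simp add: mult.left_commute[of "cs p"] distrib_left mult_ac)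
qed

lemma poisson_zonal_harmonic:
  assumes "p \<in> chart"
  shows "poisson (harmonic 0 q) (harmonic m r) p
      = \<i> * of_int m * of_real (poly (pderiv q) (cos (fst p))) * harmonic m r p"
proof -
  have "sn p * (sn p * poisson (harmonic 0 q) (harmonic m r) p)
      = - (sn p * d_theta (harmonic 0 q) p) * d_phi (harmonic m r) p"
    unfolding sn_mult_poisson[OF assms] d_phi_harmonic by simp
  also have "\<dots> = sn p * (sn p * (harmonic 0 (pderiv q) p * d_phi (harmonic m r) p))"
    unfolding sn_mult_d_theta_harmonic by (simp add: power2_eq_square)
  finally have "poisson (harmonic 0 q) (harmonic m r) p
      = harmonic 0 (pderiv q) p * d_phi (harmonic m r) p"
    using sn_nonzero[OF assms] by simp
  then show ?thesis
    unfolding d_phi_harmonic by (simp add: harmonic_def)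
qed

section \<open>The zonal field\<close>

definition zonal_coupling :: "nat \<Rightarrow> nat \<Rightarrow> nat \<Rightarrow> real" where
  "zonal_coupling k n j =
    (if j = n + 2 then 5 * (legendre_up k n * legendre_up k (n + 1))
     else if j = n then
       5 * (legendre_up k n * legendre_down k (n + 1) + legendre_down k n * legendre_up k (n - 1)) - 1
     else if j + 2 = n then 5 * (legendre_down k n * legendre_down k (n - 1))
     else 0)"

lemma zonal_mult_sph_harm:
  assumes "n \<ge> 2"
  shows "(5 * (cs p)\<^sup>2 - 1) * sph_harm m n p
      = (\<Sum>j\<in>{n + 2, n, n - 2}. of_real (zonal_coupling (nat \<bar>m\<bar>) n j) * sph_harm m j p)"
proof -
  let ?k = "nat \<bar>m\<bar>"
  have n: "n \<ge> 1" "n + 1 \<ge> 1" "n - 1 \<ge> 1" using assms by auto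
  have "(cs p)\<^sup>2 * sph_harm m n p = cs p * (cs p * sph_harm m n p)"
    by (simp add: power2_eq_square mult.assoc)
  also have "\<dots> = of_real (legendre_up ?k n) * (cs p * sph_harm m (n + 1) p)
      + of_real (legendre_down ?k n) * (cs p * sph_harm m (n - 1) p)"
    unfolding cs_mult_sph_harm[OF n(1)] by (simp add: algebra_simps)
  also have "\<dots> = of_real (legendre_up ?k n * legendre_up ?k (n + 1)) * sph_harm m (n + 2) p
      + of_real (legendre_up ?k n * legendre_down ?k (n + 1)
          + legendre_down ?k n * legendre_up ?k (n - 1)) * sph_harm m n p
      + of_real (legendre_down ?k n * legendre_down ?k (n - 1)) * sph_harm m (n - 2) p"
    unfolding cs_mult_sph_harm[OF n(2)] cs_mult_sph_harm[OF n(3)] using assms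
    by (simp add: algebra_simps numeral_2_eq_2)
  finally have cs_sq_mult: "(cs p)\<^sup>2 * sph_harm m n p = \<dots>" .
  have "n - 2 \<noteq> n + 2" "n - 2 \<noteq> n" "n - 2 + 2 = n" using assms by auto
  then show ?thesis
    unfolding left_diff_distrib mult.assoc[of 5] cs_sq_mult
    by (simp add: zonal_coupling_def algebra_simps)
qed

definition zonal_amplitude :: real where
  "zonal_amplitude = sqrt (7 / (48 * pi))"

lemma zonal_amplitude_sq: "zonal_amplitude * zonal_amplitude = 7 / (48 * pi)"
  by (simp add: zonal_amplitude_def)

definition zonal_stream :: "real \<times> real \<Rightarrow> complex" where
  "zonal_stream p = of_real zonal_amplitude * sph_harm 0 3 p"

lemma zonal_stream_eq_harmonic: "zonal_stream = harmonic 0 (smult zonal_amplitude (legendre_deriv 0 3))"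
  by (simp add: zonal_stream_def[abs_def] sph_harm_def harmonic_smult)

lemma has_laplacian_zonal_stream: "has_laplacian zonal_stream (\<lambda>p. - of_real 12 * zonal_stream p)"
  using has_laplacian_cmult[OF has_laplacian_sph_harm, of "of_real zonal_amplitude" 0 3]
  by (simp add: zonal_stream_def[abs_def] eigval_def mult.left_commute)

lemma poisson_zonal_stream:
  assumes "p \<in> chart"
  shows "poisson zonal_stream (sph_harm m n) p
    = \<i> * of_int m * of_real (3/2 * zonal_amplitude) * ((5 * (cs p)\<^sup>2 - 1) * sph_harm m n p)"
proof -
  have pderiv: "poly (pderiv (smult zonal_amplitude (legendre_deriv 0 3))) x
      = 3/2 * zonal_amplitude * (5 * x\<^sup>2 - 1)" for x
    unfolding legendre_deriv_0_3 by (simp add: pderiv_smult pderiv_pCons power2_eq_square algebra_simps)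
  show ?thesis
    unfolding zonal_stream_eq_harmonic sph_harm_def poisson_zonal_harmonic[OF assms] pderiv by simp
qed

lemma sphere_int_pderiv_cos:
  "sphere_int (\<lambda>p. of_real (poly (pderiv R) (cos (fst p))))
      = of_real (2 * pi * (poly R 1 - poly R (- 1)))"
proof -
  let ?r = "pderiv R"
  have "chart_smooth (\<lambda>p. sn p * of_real (poly ?r (cos (fst p))))"
    by (intro chart_smooth_mult chart_smooth_sn sphere_fun_chart_smooth[OF sphere_fun_poly_cs])
  then have "sphere_int (\<lambda>p. of_real (poly ?r (cos (fst p))))
      = integral {0..pi} (\<lambda>x. integral {0..2 * pi}
          (\<lambda>y. sn (x, y) * of_real (poly ?r (cos (fst (x, y))))))"
    unfolding sphere_int_def by (rule chart_int_iterated)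
  also have "(\<lambda>x. integral {0..2 * pi} (\<lambda>y. sn (x, y) * of_real (poly ?r (cos (fst (x, y)))))) =
      (\<lambda>x. complex_of_real (2 * pi * (sin x * poly ?r (cos x))))"
    by (simp add: fun_eq_iff scaleR_conv_of_real)
  also have "integral {0..pi} \<dots> = of_real (2 * pi * (poly R 1 - poly R (- 1)))"
  proof (rule integral_unique)
    have "((\<lambda>x. 2 * pi * (sin x * poly ?r (cos x))) has_integral
        2 * pi * (- poly R (cos pi)) - 2 * pi * (- poly R (cos 0))) {0..pi}"
      by (rule fundamental_theorem_of_calculus)
        (auto intro!: derivative_eq_intros DERIV_chain2[OF poly_DERIV]
          simp flip: has_real_derivative_iff_has_vector_derivative)
    from has_integral_linear[OF this bounded_linear_of_real[where 'a = complex]]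
    show "((\<lambda>x. complex_of_real (2 * pi * (sin x * poly ?r (cos x)))) has_integral
        of_real (2 * pi * (poly R 1 - poly R (- 1)))) {0..pi}"
      by (simp add: o_def algebra_simps)
  qed
  finally show ?thesis .
qed

lemma herm_zonal_field: "herm (sgrad zonal_stream) (sgrad zonal_stream) = 1"
proof -
  define R :: "real poly" where "R = smult (7 / (48 * pi)) [:0, 0, 0, 3/4, 0, - 3/2, 0, 25/28:]"
  have "poly (pderiv R) x = zonal_amplitude * zonal_amplitude * (poly (legendre_deriv 0 3) x)\<^sup>2" for x
    unfolding R_def zonal_amplitude_sq legendre_deriv_0_3
    by (simp add: pderiv_pCons pderiv_smult power2_eq_square field_simps)
  then have "zonal_stream p * cnj (zonal_stream p) = of_real (poly (pderiv R) (cos (fst p)))" for p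
    by (simp add: zonal_stream_eq_harmonic harmonic_def power2_eq_square mult_ac)
  then have "herm (sgrad zonal_stream) (sgrad zonal_stream)
      = of_real 12 * of_real (2 * pi * (poly R 1 - poly R (- 1)))"
    using herm_sgrad_eigenfunction[OF _ has_laplacian_zonal_stream]
      has_laplacian_sphere_fun(1)[OF has_laplacian_zonal_stream]
    by (simp only: sphere_int_pderiv_cos)
  also have "\<dots> = 1"
    by (simp add: R_def field_simps)
  finally show ?thesis .
qed

lemma zonal_field_coupling:
  fixes m :: int and d :: complex
  shows "eigenfield_coupling zonal_stream 12 (\<lambda>n p. d * sph_harm m n p) eigval {3..}
    (\<lambda>n. {n + 2, n, n - 2})
    (\<lambda>n j. \<i> * of_int m * of_real (3/2 * zonal_amplitude * zonal_coupling (nat \<bar>m\<bar>) n j))"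
proof
  show "has_laplacian zonal_stream (\<lambda>p. - of_real 12 * zonal_stream p)"
    by (rule has_laplacian_zonal_stream)
  show "has_laplacian (\<lambda>p. d * sph_harm m n p) (\<lambda>p. - of_real (eigval n) * (d * sph_harm m n p))" for n
    using has_laplacian_cmult[OF has_laplacian_sph_harm, of d m n] by (simp add: mult.left_commute)
  show "chart_eq (poisson zonal_stream (\<lambda>p. d * sph_harm m n p)) (\<lambda>p. \<Sum>j\<in>{n + 2, n, n - 2}.
      \<i> * of_int m * of_real (3/2 * zonal_amplitude * zonal_coupling (nat \<bar>m\<bar>) n j)
        * (d * sph_harm m j p))"
    if "n \<in> {3..}" for n
  proof (rule chart_eqI)
    fix p assume p: "p \<in> chart"
    have "n \<ge> 2" using that by simp
    show "poisson zonal_stream (\<lambda>p. d * sph_harm m n p) p = (\<Sum>j\<in>{n + 2, n, n - 2}.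
      \<i> * of_int m * of_real (3/2 * zonal_amplitude * zonal_coupling (nat \<bar>m\<bar>) n j)
        * (d * sph_harm m j p))"
      unfolding poisson_cmult[OF chart_smooth_sph_harm] poisson_zonal_stream[OF p]
        zonal_mult_sph_harm[OF \<open>n \<ge> 2\<close>] sum_distrib_left
      by (intro sum.cong) (simp_all add: mult_ac)
  qed
  show "eigval k \<noteq> 0" if "n \<in> {3..}" "k \<in> {n + 2, n, n - 2}" for n k
    using that by (intro eigval_nonzero) auto
qed (simp_all add: inj_eigval)

definition curv_coeff :: "nat \<Rightarrow> nat \<Rightarrow> real" where
  "curv_coeff k l = - (real k)\<^sup>2 * (21 / (64 * pi)) *
    (\<Sum>j\<in>{l + 2, l, l - 2}.
      zonal_coupling k l j * zonal_coupling k j l * curv_weight 12 (eigval l) (eigval j))"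

lemma sec_curv_zonal_field:
  assumes l: "l \<ge> 5" and m: "\<bar>m\<bar> \<le> int l" and d: "d \<noteq> 0"
  shows "sec_curv (sgrad zonal_stream) (sgrad (\<lambda>p. d * sph_harm m l p))
      = of_real (curv_coeff (nat \<bar>m\<bar>) l)"
proof -
  let ?k = "nat \<bar>m\<bar>" and ?\<kappa> = "3/2 * zonal_amplitude"
  let ?c = "\<lambda>n j. \<i> * of_int m * of_real (?\<kappa> * zonal_coupling ?k n j)"
  interpret eigenfield_coupling zonal_stream 12 "\<lambda>n p. d * sph_harm m n p" eigval "{3..}"
    "\<lambda>n. {n + 2, n, n - 2}" ?c
    by (rule zonal_field_coupling)
  have "sphere_int (\<lambda>p. d * sph_harm m l p * cnj (d * sph_harm m l p))
      = d * cnj d * sphere_int (\<lambda>p. sph_harm m l p * cnj (sph_harm m l p))"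
    unfolding sphere_int_cmult[symmetric] by (simp add: mult_ac)
  then have norm: "sphere_int (\<lambda>p. d * sph_harm m l p * cnj (d * sph_harm m l p)) \<noteq> 0"
    using sph_harm_norm_nonzero[of m l] m d by simp
  have "eigval l \<noteq> eigval 3"
    using l injD[OF inj_eigval] by fastforce
  then have "eigval l \<noteq> 12" by (simp add: eigval_def)
  have "- (\<i> * \<i>) * of_int m * of_int m * of_real (?\<kappa> * ?\<kappa>) = of_real ((real ?k)\<^sup>2 * (21 / (64 * pi)))"
  proof -
    have "?\<kappa> * ?\<kappa> = 9/4 * (zonal_amplitude * zonal_amplitude)" by simp
    also have "\<dots> = 21 / (64 * pi)" unfolding zonal_amplitude_sq by simp
    finally show ?thesis by (simp add: power2_eq_square)
  qed
  then have c_mult: "?c l j * ?c j l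
      = of_real (- (real ?k)\<^sup>2 * (21 / (64 * pi)) * (zonal_coupling ?k l j * zonal_coupling ?k j l))" for j
    unfolding of_real_mult of_real_minus by algebra
  have "sec_curv (sgrad zonal_stream) (sgrad (\<lambda>p. d * sph_harm m l p))
      = (\<Sum>j\<in>{l + 2, l, l - 2}. ?c l j * ?c j l * of_real (curv_weight 12 (eigval l) (eigval j)))
        / herm (sgrad zonal_stream) (sgrad zonal_stream)"
    using l by (intro sec_curv_eigenfunction norm eigval_nonzero \<open>eigval l \<noteq> 12\<close>) auto
  also have "\<dots> = of_real (curv_coeff ?k l)"
    unfolding c_mult herm_zonal_field curv_coeff_def sum_distrib_left of_real_sum
    by (simp add: mult.assoc)
  finally show ?thesis .
qed

section \<open>The basis fields\<close>

lemma one_minus_cos_squared_powr: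
  assumes "0 < t" "t < pi"
  shows "(1 - (cos t)\<^sup>2) powr (x / 2) = sin t powr x"
proof -
  have "1 - (cos t)\<^sup>2 = sin t powr 2"
    using sin_gt_zero[OF assms] by (simp add: sin_squared_eq)
  then show ?thesis by (simp add: powr_powr)
qed

lemma assoc_leg_nonneg:
  assumes "0 < t" "t < pi"
  shows "assoc_leg l (int k) (cos t) = sin t ^ k * poly (legendre_deriv k l) (cos t)"
proof -
  have "nat (int l + int k) = l + k" by simp
  then show ?thesis
    using sin_gt_zero[OF assms]
    by (simp add: assoc_leg_def one_minus_cos_squared_powr[OF assms] higher_deriv_rodrigues
      legendre_deriv_def powr_realpow)
qed

lemma assoc_leg_neg:
  assumes "k \<le> l"
  obtains e where "e \<noteq> 0"
    "\<And>t. 0 < t \<Longrightarrow> t < pi \<Longrightarrow>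
        assoc_leg l (- int k) (cos t) = e * (sin t ^ k * poly (legendre_deriv k l) (cos t))"
proof -
  obtain c where c: "c \<noteq> 0" "rodrigues l (l - k) = smult c ([:-1, 0, 1:] ^ k * rodrigues l (l + k))"
    using rodrigues_reflect[OF assms] by blast
  have "assoc_leg l (- int k) (cos t) = c * (-1) ^ k * (sin t ^ k * poly (legendre_deriv k l) (cos t))"
    if t: "0 < t" "t < pi" for t
  proof -
    have "nat (int l + - int k) = l - k" using assms by simp
    moreover have "sin t powr real_of_int (- int k) = 1 / sin t ^ k"
      using sin_gt_zero[OF t] by (simp add: powr_minus powr_realpow divide_inverse)
    moreover have "poly [:-1, 0, 1:] (cos t) = (-1) * (sin t * sin t)"
      using sin_cos_squared_add3[of t] by (simp add: algebra_simps)
    then have "poly ([:-1, 0, 1:] ^ k) (cos t) = (-1) ^ k * sin t ^ k * sin t ^ k"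
      by (simp only: poly_power power_mult_distrib mult.assoc)
    ultimately show ?thesis
      using sin_gt_zero[OF t] unfolding assoc_leg_def one_minus_cos_squared_powr[OF t]
      by (simp add: higher_deriv_rodrigues legendre_deriv_def c(2) del: poly_power)
  qed
  then show ?thesis using that[of "c * (-1) ^ k"] c(1) by simp
qed

lemma assoc_leg_cos:
  assumes "\<bar>m\<bar> \<le> int l"
  obtains e where "e \<noteq> 0" "\<And>t. 0 < t \<Longrightarrow> t < pi \<Longrightarrow>
    assoc_leg l m (cos t) = e * (sin t ^ nat \<bar>m\<bar> * poly (legendre_deriv (nat \<bar>m\<bar>) l) (cos t))"
proof (cases "m \<ge> 0")
  case True
  then show ?thesis using that[of 1] assoc_leg_nonneg[of _ l "nat m"] by simp
next
  case False
  with assms have "nat \<bar>m\<bar> \<le> l" "m = - int (nat \<bar>m\<bar>)" by auto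
  then show ?thesis using that assoc_leg_neg[of "nat \<bar>m\<bar>" l] by metis
qed

definition ebasis_norm :: "nat \<Rightarrow> int \<Rightarrow> real" where
  "ebasis_norm l m = sqrt (fact (nat (int l - m)) / fact (nat (int l + m)) * (2 * real l + 1) / (4 * pi))
    / sqrt (real l * (real l + 1))"

lemma ebasis_norm_nonzero: "l \<ge> 1 \<Longrightarrow> ebasis_norm l m \<noteq> 0"
  by (auto simp: ebasis_norm_def add_nonneg_eq_0_iff)

lemma ebasis_norm_3_0: "ebasis_norm 3 0 = zonal_amplitude"
  by (simp add: ebasis_norm_def zonal_amplitude_def flip: real_sqrt_divide)

lemma ebasis_chart_eq:
  assumes "\<And>t. 0 < t \<Longrightarrow> t < pi \<Longrightarrow>
      assoc_leg l m (cos t) = e * (sin t ^ nat \<bar>m\<bar> * poly (legendre_deriv (nat \<bar>m\<bar>) l) (cos t))"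
  shows "chart_eq (ebasis l m) (sgrad (\<lambda>p. of_real (ebasis_norm l m * e) * sph_harm m l p))"
  unfolding ebasis_def
  by (intro sgrad_chart_cong chart_eqI)
    (auto simp: Ysh_def ebasis_norm_def assms chart_def sph_harm_def harmonic_def)

lemma ebasis_sph_harm:
  assumes "\<bar>m\<bar> \<le> int l" "l \<ge> 1"
  obtains d where "d \<noteq> 0" "chart_eq (ebasis l m) (sgrad (\<lambda>p. d * sph_harm m l p))"
proof -
  obtain e where e: "e \<noteq> 0" "\<And>t. 0 < t \<Longrightarrow> t < pi \<Longrightarrow>
    assoc_leg l m (cos t) = e * (sin t ^ nat \<bar>m\<bar> * poly (legendre_deriv (nat \<bar>m\<bar>) l) (cos t))"
    using assoc_leg_cos[OF assms(1)] by blast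
  have "complex_of_real (ebasis_norm l m * e) \<noteq> 0"
    using e(1) ebasis_norm_nonzero[OF assms(2)] by simp
  then show ?thesis using that ebasis_chart_eq[OF e(2)] by blast
qed

lemma ebasis_3_0: "chart_eq (ebasis 3 0) (sgrad zonal_stream)"
proof -
  have "assoc_leg 3 0 (cos t) = 1 * (sin t ^ nat \<bar>0\<bar> * poly (legendre_deriv (nat \<bar>0\<bar>) 3) (cos t))"
    if "0 < t" "t < pi" for t
    using assoc_leg_nonneg[OF that, of 3 0] by simp
  from ebasis_chart_eq[OF this] show ?thesis
    by (simp add: zonal_stream_def[abs_def] ebasis_norm_3_0)
qed

section \<open>Asymptotics\<close>

text \<open>The square of the coefficient in the three-term recurrence of the normalized harmonics.\<close>
definition jacobi_coeff :: "real \<Rightarrow> real \<Rightarrow> real" where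
  "jacobi_coeff k x = (x\<^sup>2 - k\<^sup>2) / (4 * x\<^sup>2 - 1)"

lemma jacobi_coeff_limit:
  fixes k :: "nat \<Rightarrow> real" and j :: real
  assumes k: "(\<lambda>l. k l / real l) \<longlonglongrightarrow> r"
  shows "(\<lambda>l. jacobi_coeff (k l) (real l + j)) \<longlonglongrightarrow> (1 - r\<^sup>2) / 4"
proof -
  have "(\<lambda>l. ((real l + j) / real l)\<^sup>2) \<longlonglongrightarrow> 1" "(\<lambda>l. (4 * (real l + j)\<^sup>2 - 1) / (real l)\<^sup>2) \<longlonglongrightarrow> 4"
    by real_asymp+
  then have "(\<lambda>l. (((real l + j) / real l)\<^sup>2 - (k l / real l)\<^sup>2)
      / ((4 * (real l + j)\<^sup>2 - 1) / (real l)\<^sup>2)) \<longlonglongrightarrow> (1 - r\<^sup>2) / 4"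
    by (intro tendsto_intros k) simp_all
  moreover have "eventually (\<lambda>l. (((real l + j) / real l)\<^sup>2 - (k l / real l)\<^sup>2)
      / ((4 * (real l + j)\<^sup>2 - 1) / (real l)\<^sup>2) = jacobi_coeff (k l) (real l + j)) sequentially"
    using eventually_gt_at_top[of 0]
    by eventually_elim (simp add: jacobi_coeff_def power_divide flip: diff_divide_distrib)
  ultimately show ?thesis by (rule Lim_transform_eventually)
qed

lemma jacobi_coeff_diff_limit:
  fixes k :: "nat \<Rightarrow> real" and j :: real
  assumes k: "(\<lambda>l. k l / real l) \<longlonglongrightarrow> r"
  shows "(\<lambda>l. real l * (jacobi_coeff (k l) (real l + j + 1) - jacobi_coeff (k l) (real l + j - 1)))
      \<longlonglongrightarrow> r\<^sup>2"
proof -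
  let ?f = "\<lambda>x::real. 1 / (4 * (x + j - 1)\<^sup>2 - 1) - 1 / (4 * (x + j + 1)\<^sup>2 - 1)"
  have jacobi: "jacobi_coeff c x = 1/4 - (c\<^sup>2 - 1/4) * (1 / (4 * x\<^sup>2 - 1))" if "4 * x\<^sup>2 - 1 > 0" for c x
    using that by (simp add: jacobi_coeff_def field_simps)
  have "(\<lambda>l. real l ^ 3 * ?f (real l)) \<longlonglongrightarrow> 1"
    by real_asymp (simp add: field_simps)
  moreover have "(\<lambda>l. (k l / real l)\<^sup>2 - 1 / (4 * (real l)\<^sup>2)) \<longlonglongrightarrow> r\<^sup>2 - 0"
    by (intro tendsto_diff tendsto_power k) real_asymp
  ultimately have "(\<lambda>l. ((k l / real l)\<^sup>2 - 1 / (4 * (real l)\<^sup>2)) * (real l ^ 3 * ?f (real l)))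
      \<longlonglongrightarrow> (r\<^sup>2 - 0) * 1"
    by (intro tendsto_mult)
  moreover have "eventually (\<lambda>l. ((k l / real l)\<^sup>2 - 1 / (4 * (real l)\<^sup>2)) * (real l ^ 3 * ?f (real l))
      = real l * (jacobi_coeff (k l) (real l + j + 1) - jacobi_coeff (k l) (real l + j - 1)))
      sequentially"
  proof -
    have "eventually (\<lambda>l. 4 * (real l + j - 1)\<^sup>2 - 1 > 0) sequentially"
      "eventually (\<lambda>l. 4 * (real l + j + 1)\<^sup>2 - 1 > 0) sequentially"
      by real_asymp+
    then show ?thesis
      using eventually_gt_at_top[of 0]
    proof eventually_elim
      case (elim l)
      have "((k l / real l)\<^sup>2 - 1 / (4 * (real l)\<^sup>2)) * real l ^ 3 = real l * ((k l)\<^sup>2 - 1/4)"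
        using elim(3) by (simp add: field_simps power2_eq_square power3_eq_cube)
      then have "((k l / real l)\<^sup>2 - 1 / (4 * (real l)\<^sup>2)) * (real l ^ 3 * ?f (real l))
          = real l * ((k l)\<^sup>2 - 1/4) * ?f (real l)"
        by (simp only: mult.assoc[symmetric])
      also have "\<dots> = real l * (jacobi_coeff (k l) (real l + j + 1) - jacobi_coeff (k l) (real l + j - 1))"
        unfolding jacobi[OF elim(1)] jacobi[OF elim(2)] by (simp add: algebra_simps)
      finally show ?case .
    qed
  qed
  ultimately show ?thesis
    by (simp add: Lim_transform_eventually)
qed

lemma curv_weight_self: "L \<noteq> 0 \<Longrightarrow> curv_weight \<nu> L L = - (\<nu> / L)\<^sup>2 / 4"
  by (simp add: curv_weight_def field_simps power2_eq_square)

lemma curv_weight_limits: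
  fixes \<nu> :: real
  defines "w \<equiv> \<lambda>x y. curv_weight \<nu> (x * (x + 1)) (y * (y + 1))"
  shows "(\<lambda>l. real l * w (real l) (real l + 2)) \<longlonglongrightarrow> 4"
    and "(\<lambda>l. (real l)\<^sup>2 * (w (real l) (real l + 2) + w (real l) (real l - 2))) \<longlonglongrightarrow> 0"
    and "(\<lambda>l. (real l)\<^sup>2 * w (real l) (real l)) \<longlonglongrightarrow> 0"
proof -
  show "(\<lambda>l. real l * w (real l) (real l + 2)) \<longlonglongrightarrow> 4"
    unfolding w_def curv_weight_def by real_asymp
  show "(\<lambda>l. (real l)\<^sup>2 * (w (real l) (real l + 2) + w (real l) (real l - 2))) \<longlonglongrightarrow> 0"
    unfolding w_def curv_weight_def by real_asymp (simp add: field_simps)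
  have "(\<lambda>l. - \<nu>\<^sup>2 / 4 * ((real l)\<^sup>2 / (real l * (real l + 1))\<^sup>2)) \<longlonglongrightarrow> - \<nu>\<^sup>2 / 4 * 0"
    by (rule tendsto_mult_left) real_asymp
  moreover have "eventually (\<lambda>l. - \<nu>\<^sup>2 / 4 * ((real l)\<^sup>2 / (real l * (real l + 1))\<^sup>2)
      = (real l)\<^sup>2 * w (real l) (real l)) sequentially"
    using eventually_gt_at_top[of 0]
    by eventually_elim (simp add: w_def curv_weight_self power_divide add_nonneg_eq_0_iff mult_ac)
  ultimately show "(\<lambda>l. (real l)\<^sup>2 * w (real l) (real l)) \<longlonglongrightarrow> 0"
    by (simp add: Lim_transform_eventually)
qed

lemma legendre_down_up: "legendre_down k (n + 1) * legendre_up k n = jacobi_coeff (real k) (real n + 1)"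
  by (simp add: legendre_down_def legendre_up_def jacobi_coeff_def power2_eq_square algebra_simps)

lemma zonal_coupling_mult:
  shows "zonal_coupling k l (l + 2) * zonal_coupling k (l + 2) l
      = 25 * (jacobi_coeff (real k) (real l + 1) * jacobi_coeff (real k) (real l + 2))"
    and "l \<ge> 1 \<Longrightarrow> zonal_coupling k l l
      = 5 * (jacobi_coeff (real k) (real l + 1) + jacobi_coeff (real k) (real l)) - 1"
    and "l \<ge> 2 \<Longrightarrow> zonal_coupling k l (l - 2) * zonal_coupling k (l - 2) l
      = 25 * (jacobi_coeff (real k) (real l) * jacobi_coeff (real k) (real l - 1))"
proof -
  show "zonal_coupling k l (l + 2) * zonal_coupling k (l + 2) l
      = 25 * (jacobi_coeff (real k) (real l + 1) * jacobi_coeff (real k) (real l + 2))" for l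
    using legendre_down_up[of k l] legendre_down_up[of k "l + 1"]
    by (simp add: zonal_coupling_def algebra_simps)
  note shift = this
  show "zonal_coupling k l l = 5 * (jacobi_coeff (real k) (real l + 1) + jacobi_coeff (real k) (real l))
      - 1" if "l \<ge> 1"
    using legendre_down_up[of k l] legendre_down_up[of k "l - 1"] that
    by (simp add: zonal_coupling_def of_nat_diff mult.commute)
  show "zonal_coupling k l (l - 2) * zonal_coupling k (l - 2) l
      = 25 * (jacobi_coeff (real k) (real l) * jacobi_coeff (real k) (real l - 1))" if "l \<ge> 2"
  proof -
    have "l - 2 + 2 = l" using that by simp
    then show ?thesis
      using shift[of "l - 2"] that by (simp only: of_nat_diff) (simp add: mult.commute)
  qed
qed

lemma curv_coeff_eq:
  fixes k l :: nat
  assumes "l \<ge> 2"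
  defines "a \<equiv> \<lambda>j. jacobi_coeff (real k) (real l + j)"
    and "w \<equiv> \<lambda>x y. curv_weight 12 (x * (x + 1)) (y * (y + 1))"
  shows "curv_coeff k l = - (real k)\<^sup>2 * (21 / (64 * pi)) *
    (25 * (a 1 * a 2) * w (real l) (real l + 2) + (5 * (a 1 + a 0) - 1)\<^sup>2 * w (real l) (real l)
      + 25 * (a 0 * a (- 1)) * w (real l) (real l - 2))"
proof -
  have "curv_weight 12 (eigval l) (eigval (l + 2)) = w (real l) (real l + 2)"
    "curv_weight 12 (eigval l) (eigval l) = w (real l) (real l)"
    "curv_weight 12 (eigval l) (eigval (l - 2)) = w (real l) (real l - 2)"
    using assms(1) by (simp_all add: w_def eigval_def of_nat_diff add_ac)
  moreover have "(\<Sum>j\<in>{l + 2, l, l - 2}. f j) = f (l + 2) + (f l + f (l - 2))" for f :: "nat \<Rightarrow> real"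
  proof -
    have "l - 2 \<noteq> l + 2" "l - 2 \<noteq> l" using assms(1) by auto
    then show ?thesis by simp
  qed
  ultimately show ?thesis
    using assms(1)
    by (simp only: curv_coeff_def zonal_coupling_mult a_def)
      (simp add: power2_eq_square zonal_coupling_mult(2))
qed

lemma curv_coeff_limit:
  fixes k :: "nat \<Rightarrow> nat" and r :: real
  assumes k: "(\<lambda>l. real (k l) / real l) \<longlonglongrightarrow> r"
  shows "(\<lambda>l. curv_coeff (k l) l) \<longlonglongrightarrow> - 525 / (32 * pi) * r ^ 4 * (1 - r\<^sup>2)"
proof -
  let ?w = "\<lambda>x y. curv_weight 12 (x * (x + 1)) (y * (y + 1))"
  define \<rho> where "\<rho> l = real (k l) / real l" for l
  define a where "a j l = jacobi_coeff (real (k l)) (real l + j)" for j l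
  define d where "d l = a 1 l * (real l * (a 2 l - a 0 l)) + a 0 l * (real l * (a 1 l - a (- 1) l))"
    for l
  have a: "a j \<longlonglongrightarrow> (1 - r\<^sup>2) / 4" for j
    unfolding a_def[abs_def] by (rule jacobi_coeff_limit[OF k])
  have diff: "(\<lambda>l. real l * (a 2 l - a 0 l)) \<longlonglongrightarrow> r\<^sup>2" "(\<lambda>l. real l * (a 1 l - a (- 1) l)) \<longlonglongrightarrow> r\<^sup>2"
    using jacobi_coeff_diff_limit[OF k, of 1] jacobi_coeff_diff_limit[OF k, of 0]
    by (simp_all add: a_def add.commute)
  have d: "d \<longlonglongrightarrow> (1 - r\<^sup>2) / 4 * r\<^sup>2 + (1 - r\<^sup>2) / 4 * r\<^sup>2"
    unfolding d_def[abs_def] by (intro tendsto_intros a diff)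
  let ?F = "\<lambda>l. - (21 / (64 * pi)) * (\<rho> l)\<^sup>2 *
      (25 * (d l * (real l * ?w (real l) (real l + 2))
             + a 0 l * a (- 1) l * ((real l)\<^sup>2 * (?w (real l) (real l + 2) + ?w (real l) (real l - 2))))
       + (5 * (a 1 l + a 0 l) - 1)\<^sup>2 * ((real l)\<^sup>2 * ?w (real l) (real l)))"
  have "?F \<longlonglongrightarrow> - (21 / (64 * pi)) * r\<^sup>2 *
      (25 * (((1 - r\<^sup>2) / 4 * r\<^sup>2 + (1 - r\<^sup>2) / 4 * r\<^sup>2) * 4 + (1 - r\<^sup>2) / 4 * ((1 - r\<^sup>2) / 4) * 0)
       + (5 * ((1 - r\<^sup>2) / 4 + (1 - r\<^sup>2) / 4) - 1)\<^sup>2 * 0)"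
    by (intro tendsto_intros a d k[folded \<rho>_def] curv_weight_limits)
  also have "- (21 / (64 * pi)) * r\<^sup>2 *
      (25 * (((1 - r\<^sup>2) / 4 * r\<^sup>2 + (1 - r\<^sup>2) / 4 * r\<^sup>2) * 4 + (1 - r\<^sup>2) / 4 * ((1 - r\<^sup>2) / 4) * 0)
       + (5 * ((1 - r\<^sup>2) / 4 + (1 - r\<^sup>2) / 4) - 1)\<^sup>2 * 0) = - 525 / (32 * pi) * r ^ 4 * (1 - r\<^sup>2)"
    by (simp add: field_simps)
  finally have "?F \<longlonglongrightarrow> - 525 / (32 * pi) * r ^ 4 * (1 - r\<^sup>2)" .
  moreover have "eventually (\<lambda>l. ?F l = curv_coeff (k l) l) sequentially"
    using eventually_ge_at_top[of 2]
  proof eventually_elim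
    case (elim l)
    then have "real (k l) = \<rho> l * real l"
      by (simp add: \<rho>_def)
    with elim show ?case
      by (simp add: curv_coeff_eq a_def d_def algebra_simps power2_eq_square)
  qed
  ultimately show ?thesis by (rule Lim_transform_eventually)
qed

theorem theorem5:
  fixes m :: "nat \<Rightarrow> int" and q :: real
  assumes "\<forall>l\<ge>3. \<bar>m l\<bar> \<le> int l"
    and "(\<lambda>l. real_of_int (m l) / real l) \<longlonglongrightarrow> q"
  shows "(\<lambda>l. sec_curv (ebasis 3 0) (ebasis l (m l)))
           \<longlonglongrightarrow> complex_of_real (- 525 / (32 * pi) * q ^ 4 * (1 - q\<^sup>2))"
proof -
  have "(\<lambda>l. real (nat \<bar>m l\<bar>) / real l) \<longlonglongrightarrow> \<bar>q\<bar>"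
    using tendsto_rabs[OF assms(2)] by simp
  from curv_coeff_limit[OF this]
  have limit: "(\<lambda>l. complex_of_real (curv_coeff (nat \<bar>m l\<bar>) l))
      \<longlonglongrightarrow> complex_of_real (- 525 / (32 * pi) * q ^ 4 * (1 - q\<^sup>2))"
    by (intro tendsto_of_real) simp
  have "complex_of_real (curv_coeff (nat \<bar>m l\<bar>) l) = sec_curv (ebasis 3 0) (ebasis l (m l))"
    if l: "l \<ge> 5" for l
  proof -
    have m: "\<bar>m l\<bar> \<le> int l" using assms(1) l by simp
    obtain d where d: "d \<noteq> 0" "chart_eq (ebasis l (m l)) (sgrad (\<lambda>p. d * sph_harm (m l) l p))"
      using ebasis_sph_harm[OF m] l by auto
    have "sec_curv (ebasis 3 0) (ebasis l (m l))
        = sec_curv (sgrad zonal_stream) (sgrad (\<lambda>p. d * sph_harm (m l) l p))"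
      by (rule sec_curv_chart_cong[OF ebasis_3_0 d(2)])
    also have "\<dots> = of_real (curv_coeff (nat \<bar>m l\<bar>) l)"
      by (rule sec_curv_zonal_field[OF l m d(1)])
    finally show ?thesis by simp
  qed
  with limit show ?thesis
    by (intro Lim_transform_eventually[OF limit]) (auto intro: eventually_sequentiallyI[of 5])
qed

end
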